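(* Let $n\ge 3$, let $X=\{1,\dots,n\}$ be the ring (indices taken modulo $n$), and let $Q=(q_{ij})_{i,j\in X}$ be the transition rate matrix whose only nonzero off-diagonal entries are the indeterminates $q_{i,i+1}$ and $q_{i+1,i}$ ($i\in X$), with $q_{ii}=-q_{i,i-1}-q_{i,i+1}$. Let $T$ be the set of oriented covering rooted trees of the ring, $R=(r_{st})_{s,t\in T}$ the transition matrix of the lifted chain, and $\pi(t)$ the weight of $t\in T$. Let $\Psi$ be the polynomial in the variables $q_{ij}$ such that $\det(-R^{(t)})=\pi(t)\Psi$ for all $t\in T$. Then $$\Psi=\prod_{i=1}^n\det(-Q^{(i)}),$$ i.e. $\Psi$ is the product of all symmetric minors of size $n-1$ of $-Q$. Equivalently, for every $t\in T$, $\det(-R^{(t)})=\pi(t)\prod_{i=1}^n\det(-Q^{(i)})$.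
   Context: The ring of size $n$ is the oriented graph on $X=\{1,\dots,n\}$ with edges $(i,i+1)$ and $(i,i-1)$ for all $i$, indices modulo $n$. A covering tree rooted at $i$ is an oriented subgraph which is a tree such that for every $j\in X$ there is a unique oriented path from $j$ to $i$; $T=\bigcup_i T_i$ is the set of all covering rooted trees, $T_i$ those rooted at $i$. For $t\in T$, $\pi(t)$ is the product of $q_{kl}$ over the oriented edges $(k,l)$ of $t$. The lifted matrix $R$ is defined as follows: for $s\in T$ rooted at $i$ and $j$ with $q_{ij}$ a variable (i.e. $j=i\pm1$), remove from $s$ the unique edge coming out of $j$ and add the edge $(i,j)$, obtaining a tree $t$ rooted at $j$; set $r_{st}=q_{ij}$. All other off-diagonal entries of $R$ are $0$, and diagonal entries are chosen so that each row of $R$ sums to $0$ (so $r_{ss}=q_{ii}$ if $s$ is rooted at $i$). For a square matrix $M$ indexed by a set $S$ and $s\in S$, $M^{(s)}$ denotes $M$ with row and column $s$ deleted. A symmetric minor of size $k$ is the determinant of a submatrix obtained by deleting the same set of rows and columns. *)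

theory Defs
  imports
    "Graph_Theory.Graph_Theory"
    "Jordan_Normal_Form.Determinant"
    "HOL-Combinatorics.Permutations"
    "HOL-Library.Poly_Mapping"
begin

section \<open>Determinants of matrices indexed by a finite set\<close>

text \<open>
  A square matrix indexed by a finite set \<open>S\<close> is a function of two arguments that is only looked
  at on \<open>S \<times> S\<close>. Deleting row and column \<open>s\<close> from it, or more generally passing to a symmetric
  minor, amounts to replacing \<open>S\<close> by \<open>S - {s}\<close>, or by a smaller subset.
\<close>

definition det_on :: "'i set \<Rightarrow> ('i \<Rightarrow> 'i \<Rightarrow> 'r::comm_ring_1) \<Rightarrow> 'r" where
  "det_on S M = (\<Sum>p | p permutes S. of_int (sign p) * (\<Prod>i\<in>S. M i (p i)))"

lemma det_on_eq_det:
  assumes e: "bij_betw e {0..<m} S"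
  shows "det_on S M = Determinant.det (mat m m (\<lambda>(a, b). M (e a) (e b)))"
proof -
  let ?A = "{0..<m}"
  have inj: "inj_on e ?A" and img: "e ` ?A = S"
    using e by (auto simp: bij_betw_def)
  have "(\<lambda>p. map_permutation ?A e p) =
      (\<lambda>p x. if x \<in> S then e (p (inv_into ?A e x)) else x)"
    by (auto simp: fun_eq_iff map_permutation_def restrict_id_def img)
  with bij_betw_permutations[OF e]
  have perms: "bij_betw (map_permutation ?A e) {p. p permutes ?A} {p. p permutes S}"
    by simp
  have "det_on S M
      = (\<Sum>p | p permutes ?A. of_int (sign (map_permutation ?A e p)) *
          (\<Prod>i\<in>S. M i (map_permutation ?A e p i)))"
    unfolding det_on_def
    by (rule sum.reindex_bij_betw[OF perms, symmetric])
  also have "\<dots> = (\<Sum>p | p permutes ?A. of_int (sign p) * (\<Prod>a\<in>?A. M (e a) (e (p a))))"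
  proof (rule sum.cong[OF refl])
    fix p assume "p \<in> {p. p permutes ?A}"
    then have p: "p permutes ?A" by simp
    have "(\<Prod>i\<in>S. M i (map_permutation ?A e p i))
        = (\<Prod>a\<in>?A. M (e a) (map_permutation ?A e p (e a)))"
      by (rule prod.reindex_bij_betw[OF e, symmetric])
    also have "\<dots> = (\<Prod>a\<in>?A. M (e a) (e (p a)))"
      by (rule prod.cong[OF refl]) (simp add: map_permutation_apply[OF inj])
    finally show "of_int (sign (map_permutation ?A e p)) *
          (\<Prod>i\<in>S. M i (map_permutation ?A e p i))
        = of_int (sign p) * (\<Prod>a\<in>?A. M (e a) (e (p a)))"
      using sign_map_permutation[OF inj p] by simp
  qed
  also have "\<dots> = Determinant.det (mat m m (\<lambda>(a, b). M (e a) (e b)))"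
    unfolding Determinant.det_def
    by (auto intro!: sum.cong prod.cong simp: permutes_in_image)
  finally show ?thesis .
qed


section \<open>Covering rooted trees and the lifted chain of a digraph\<close>

text \<open>
  An oriented graph is an oriented tree if its underlying undirected multigraph is a tree. The
  library's \<open>tree\<close> only excludes directed cycles, hence the explicit condition: two antiparallel
  arcs form an undirected cycle, and since \<open>mk_symmetric\<close> contains both orientations of each edge,
  its undirected cycles are its cycles of length other than 2.
\<close>

definition oriented_tree :: "'v pair_pre_digraph \<Rightarrow> bool" where
  "oriented_tree t \<longleftrightarrow>
     connected (with_proj t) \<and>
     (\<forall>u v. (u, v) \<in> parcs t \<longrightarrow> (v, u) \<notin> parcs t) \<and>
     (\<forall>p. pre_digraph.cycle (with_proj (mk_symmetric (with_proj t))) p \<longrightarrow> length p = 2)"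

definition covering_trees_at :: "'v pair_pre_digraph \<Rightarrow> 'v \<Rightarrow> 'v pair_pre_digraph set" where
  "covering_trees_at G i =
     {t. subgraph (with_proj t) (with_proj G) \<and> oriented_tree t \<and>
         (\<forall>j\<in>pverts G. \<exists>!p. pre_digraph.apath (with_proj t) j p i)}"

definition covering_trees :: "'v pair_pre_digraph \<Rightarrow> 'v pair_pre_digraph set" where
  "covering_trees G = (\<Union>i\<in>pverts G. covering_trees_at G i)"

definition tree_root :: "'v pair_pre_digraph \<Rightarrow> 'v pair_pre_digraph \<Rightarrow> 'v" where
  "tree_root G t = (THE i. i \<in> pverts G \<and> t \<in> covering_trees_at G i)"

definition tree_weight :: "('v \<Rightarrow> 'v \<Rightarrow> 'r::comm_ring_1) \<Rightarrow> 'v pair_pre_digraph \<Rightarrow> 'r" where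
  "tree_weight q t = (\<Prod>(k, l)\<in>parcs t. q k l)"

text \<open>For \<open>s\<close> rooted at \<open>i\<close>: remove the arc coming out of \<open>j\<close> and add the arc \<open>(i, j)\<close>.\<close>

definition lift_tree :: "'v pair_pre_digraph \<Rightarrow> 'v \<Rightarrow> 'v \<Rightarrow> 'v pair_pre_digraph" where
  "lift_tree s i j = s\<lparr>parcs := insert (i, j) {e \<in> parcs s. fst e \<noteq> j}\<rparr>"

definition lifted_offdiag ::
    "'v pair_pre_digraph \<Rightarrow> ('v \<Rightarrow> 'v \<Rightarrow> 'r::comm_ring_1)
     \<Rightarrow> 'v pair_pre_digraph \<Rightarrow> 'v pair_pre_digraph \<Rightarrow> 'r" where
  "lifted_offdiag G q s t =
     (let i = tree_root G s; j = tree_root G t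
      in if (i, j) \<in> parcs G \<and> t = lift_tree s i j then q i j else 0)"

definition lifted_matrix ::
    "'v pair_pre_digraph \<Rightarrow> ('v \<Rightarrow> 'v \<Rightarrow> 'r::comm_ring_1)
     \<Rightarrow> 'v pair_pre_digraph \<Rightarrow> 'v pair_pre_digraph \<Rightarrow> 'r" where
  "lifted_matrix G q s t =
     (if s = t then - (\<Sum>u\<in>covering_trees G - {s}. lifted_offdiag G q s u)
      else lifted_offdiag G q s t)"


section \<open>The ring with indeterminate transition rates\<close>

definition ring_succ :: "nat \<Rightarrow> nat \<Rightarrow> nat" where
  "ring_succ n i = (if i = n then 1 else i + 1)"

definition ring_pred :: "nat \<Rightarrow> nat \<Rightarrow> nat" where
  "ring_pred n i = (if i = 1 then n else i - 1)"

definition ring_graph :: "nat \<Rightarrow> nat pair_pre_digraph" where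
  "ring_graph n =
     \<lparr>pverts = {1..n},
      parcs = {(i, j). i \<in> {1..n} \<and> (j = ring_succ n i \<or> j = ring_pred n i)}\<rparr>"

text \<open>
  Polynomials with coefficients in \<open>'a\<close> in indeterminates indexed by pairs of natural numbers:
  a monomial is a finitely supported exponent function, a polynomial a finitely supported function
  on monomials, multiplied by convolution.
\<close>

type_synonym 'a rate_poly = "((nat \<times> nat) \<Rightarrow>\<^sub>0 nat) \<Rightarrow>\<^sub>0 'a"

definition rate_var :: "nat \<Rightarrow> nat \<Rightarrow> 'a::idom rate_poly" where
  "rate_var i j = Poly_Mapping.single (Poly_Mapping.single (i, j) 1) 1"

definition ring_rates :: "nat \<Rightarrow> nat \<Rightarrow> nat \<Rightarrow> 'a::idom rate_poly" where
  "ring_rates n i j =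
     (if i = j then - rate_var i (ring_pred n i) - rate_var i (ring_succ n i)
      else if (i, j) \<in> parcs (ring_graph n) then rate_var i j
      else 0)"

end

theory Submission
  imports Defs "HOL-Library.Product_Lexorder"
begin

text \<open>
  A tree of the ring is given by its root \<open>i\<close> and the number \<open>a\<close> of its arcs pointing forwards; a
  step \<open>i \<mapsto> i \<plusminus> 1\<close> of the lifted chain changes \<open>a\<close> by \<open>\<plusminus>1\<close>, truncated to \<open>0 \<le> a < n\<close>. Two copies
  of the chain started in \<open>(i, a)\<close> and \<open>(i, a - 1)\<close> move in parallel until they merge, so the
  differences of their point masses span an invariant subspace that splits into \<open>n\<close> walks
  killed at a vertex \<open>w\<close>, with generators \<open>Q\<^sup>(\<^sup>w\<^sup>)\<close>; the quotient by this subspace is the chain \<open>Q\<close>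
  itself. This factorizes the determinant of a rank-one perturbation of \<open>-R\<close>. Since the tree
  weights form a left null vector of \<open>R\<close>, this determinant agrees with the minors of \<open>-R\<close> up to
  the weights. The same argument applied to \<open>Q\<close>, whose minors are tridiagonal determinants,
  evaluates the remaining factor.
\<close>

section \<open>Determinants\<close>

text \<open>A killing vertex arises because the trees of \<open>(i, a)\<close> and
  \<open>(i, a - 1)\<close> differ in one arc only, the one out of \<open>w = i - a\<close> modulo
  \<open>n\<close>. A parallel step keeps \<open>i - a\<close>, and when the root reaches
  \<open>w\<close> that arc is removed from both trees, which then coincide. The truncation of
  \<open>a\<close> at \<open>0\<close> and at \<open>n - 1\<close> is exactly this event.

  The change of basis does not commute with deleting a row and a column, and det(-R) itself is 0.
  The perturbation \<open>1 c^T\<close> avoids both obstacles: its rows are all equal, so it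
  vanishes on differences, and with \<open>c\<close> the unit vector at \<open>(1, 0)\<close> it
  induces on the quotient a perturbation of -Q of the same kind, at vertex 1. Returning to minors
  requires cancelling the total weight and the weight of one root. These are nonzero because the
  rates are indeterminates; setting all variables to 1 would only give n^2 and n, which may vanish
  in positive characteristic.\<close>

lemma finite_enum:
  assumes "finite S"
  obtains e where "bij_betw e {0..<card S} S"
  using ex_bij_betw_nat_finite[OF assms] by blast

lemma det_on_cong:
  assumes "S = S'" "\<And>i j. i \<in> S' \<Longrightarrow> j \<in> S' \<Longrightarrow> M i j = N i j"
  shows "det_on S M = det_on S' N"
  unfolding det_on_def
  by (rule sum.cong) (auto intro!: prod.cong simp: assms permutes_in_image)

lemma det_on_reindex:
  assumes "bij_betw f S T" "finite S"
  shows "det_on T M = det_on S (\<lambda>i j. M (f i) (f j))"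
proof -
  obtain e where e: "bij_betw e {0..<card S} S"
    using finite_enum[OF assms(2)] .
  have "bij_betw (f \<circ> e) {0..<card S} T"
    using e assms(1) by (rule bij_betw_trans)
  from det_on_eq_det[OF this, of M] det_on_eq_det[OF e, of "\<lambda>i j. M (f i) (f j)"]
  show ?thesis by simp
qed

lemma det_on_mult:
  assumes "finite S"
  shows "det_on S (\<lambda>i j. \<Sum>k\<in>S. A i k * B k j) = det_on S A * det_on S B"
proof -
  obtain e where e: "bij_betw e {0..<card S} S"
    using finite_enum[OF assms] .
  let ?m = "card S"
  let ?mat = "\<lambda>M. mat ?m ?m (\<lambda>(a, b). M (e a) (e b))"
  have "?mat (\<lambda>i j. \<Sum>k\<in>S. A i k * B k j) = ?mat A * ?mat B"
  proof (rule eq_matI)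
    fix i j assume ij: "i < dim_row (?mat A * ?mat B)" "j < dim_col (?mat A * ?mat B)"
    have "(\<Sum>k\<in>S. A (e i) k * B k (e j)) = (\<Sum>l\<in>{0..<?m}. A (e i) (e l) * B (e l) (e j))"
      by (rule sum.reindex_bij_betw[OF e, symmetric])
    with ij show "?mat (\<lambda>i j. \<Sum>k\<in>S. A i k * B k j) $$ (i, j) = (?mat A * ?mat B) $$ (i, j)"
      by (simp add: scalar_prod_def)
  qed auto
  moreover have "det (?mat A * ?mat B) = det (?mat A) * det (?mat B)"
    by (rule det_mult[of _ ?m]) auto
  ultimately show ?thesis
    by (simp add: det_on_eq_det[OF e])
qed

lemma det_on_empty [simp]: "det_on {} M = 1"
  by (simp add: det_on_def)

lemma det_on_singleton [simp]: "det_on {x} M = M x x"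
  by (simp add: det_on_def)

lemma det_on_block:
  fixes M :: "'i \<Rightarrow> 'i \<Rightarrow> 'r::idom"
  assumes fin: "finite A" "finite B" and disj: "A \<inter> B = {}"
    and zero: "\<And>a b. a \<in> A \<Longrightarrow> b \<in> B \<Longrightarrow> M a b = 0"
  shows "det_on (A \<union> B) M = det_on A M * det_on B M"
proof -
  obtain f where f: "bij_betw f {0..<card A} A"
    using finite_enum[OF fin(1)] .
  obtain g where g: "bij_betw g {0..<card B} B"
    using finite_enum[OF fin(2)] .
  let ?m = "card A" and ?k = "card B"
  define e where "e x = (if x < ?m then f x else g (x - ?m))" for x
  have e1: "bij_betw e {0..<?m} A"
    using f by (rule bij_betw_cong[THEN iffD1, rotated]) (simp add: e_def)
  have sh: "bij_betw (\<lambda>x. x - ?m) {?m..<?m + ?k} {0..<?k}"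
    by (rule bij_betw_byWitness[where f' = "\<lambda>x. x + ?m"]) auto
  have "bij_betw (\<lambda>x. g (x - ?m)) {?m..<?m + ?k} B"
    using bij_betw_trans[OF sh g] by (simp add: o_def)
  then have e2: "bij_betw e {?m..<?m + ?k} B"
    by (rule bij_betw_cong[THEN iffD1, rotated]) (simp add: e_def)
  have "bij_betw e ({0..<?m} \<union> {?m..<?m + ?k}) (A \<union> B)"
    by (rule bij_betw_combine[OF e1 e2 disj])
  then have e: "bij_betw e {0..<?m + ?k} (A \<union> B)"
    by (simp add: ivl_disj_un)
  let ?A1 = "mat ?m ?m (\<lambda>(a, b). M (f a) (f b))"
  let ?A3 = "mat ?k ?m (\<lambda>(a, b). M (g a) (f b))"
  let ?A4 = "mat ?k ?k (\<lambda>(a, b). M (g a) (g b))"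
  have "mat (?m + ?k) (?m + ?k) (\<lambda>(a, b). M (e a) (e b))
      = four_block_mat ?A1 (0\<^sub>m ?m ?k) ?A3 ?A4"
  proof (rule eq_matI)
    fix i j
    assume ij: "i < dim_row (four_block_mat ?A1 (0\<^sub>m ?m ?k) ?A3 ?A4)"
      "j < dim_col (four_block_mat ?A1 (0\<^sub>m ?m ?k) ?A3 ?A4)"
    have "f i \<in> A" if "i < ?m" using f that by (auto simp: bij_betw_def)
    moreover have "g (j - ?m) \<in> B" if "\<not> j < ?m"
    proof -
      have "j - ?m \<in> {0..<?k}" using that ij by auto
      then show ?thesis using g by (auto simp: bij_betw_def)
    qed
    ultimately have "M (f i) (g (j - ?m)) = 0" if "i < ?m" "\<not> j < ?m"
      using that zero by simp
    with ij show "mat (?m + ?k) (?m + ?k) (\<lambda>(a, b). M (e a) (e b)) $$ (i, j)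
        = four_block_mat ?A1 (0\<^sub>m ?m ?k) ?A3 ?A4 $$ (i, j)"
      by (auto simp: e_def)
  qed auto
  moreover have "det (four_block_mat ?A1 (0\<^sub>m ?m ?k) ?A3 ?A4) = det ?A1 * det ?A4"
    by (rule det_four_block_mat_upper_right_zero) auto
  ultimately show ?thesis
    by (simp add: det_on_eq_det[OF e] det_on_eq_det[OF f] det_on_eq_det[OF g])
qed

lemma det_on_block':
  fixes M :: "'i \<Rightarrow> 'i \<Rightarrow> 'r::idom"
  assumes fin: "finite A" "finite B" and disj: "A \<inter> B = {}"
    and zero: "\<And>a b. a \<in> A \<Longrightarrow> b \<in> B \<Longrightarrow> M b a = 0"
  shows "det_on (A \<union> B) M = det_on A M * det_on B M"
  using det_on_block[of B A M] assms by (auto simp: Un_commute mult.commute)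

lemma det_on_remove_row:
  fixes M :: "'i \<Rightarrow> 'i \<Rightarrow> 'r::idom"
  assumes "finite S" "t \<in> S" "\<And>j. j \<in> S \<Longrightarrow> j \<noteq> t \<Longrightarrow> M t j = 0"
  shows "det_on S M = M t t * det_on (S - {t}) M"
proof -
  have "det_on ({t} \<union> (S - {t})) M = det_on {t} M * det_on (S - {t}) M"
    using assms by (intro det_on_block) auto
  then show ?thesis using assms(2) by (simp add: insert_absorb)
qed

lemma det_on_remove_col:
  fixes M :: "'i \<Rightarrow> 'i \<Rightarrow> 'r::idom"
  assumes "finite S" "t \<in> S" "\<And>j. j \<in> S \<Longrightarrow> j \<noteq> t \<Longrightarrow> M j t = 0"
  shows "det_on S M = M t t * det_on (S - {t}) M"
proof -
  have "det_on ({t} \<union> (S - {t})) M = det_on {t} M * det_on (S - {t}) M"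
    using assms by (intro det_on_block') auto
  then show ?thesis using assms(2) by (simp add: insert_absorb)
qed

lemma det_on_upper_triangular:
  fixes M :: "nat \<Rightarrow> nat \<Rightarrow> 'r::idom"
  assumes "\<And>i j. 1 \<le> j \<Longrightarrow> j < i \<Longrightarrow> i \<le> N \<Longrightarrow> M i j = 0"
  shows "det_on {1..N} M = (\<Prod>i=1..N. M i i)"
  using assms
proof (induction N)
  case (Suc N)
  have "det_on {1..Suc N} M = M (Suc N) (Suc N) * det_on ({1..Suc N} - {Suc N}) M"
    using Suc.prems by (intro det_on_remove_row) auto
  also have "{1..Suc N} - {Suc N} = {1..N}" by auto
  also have "det_on {1..N} M = (\<Prod>i=1..N. M i i)"
    using Suc by auto
  finally show ?case by (simp add: mult.commute)
qed simp

lemma det_on_lower_triangular: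
  fixes M :: "nat \<Rightarrow> nat \<Rightarrow> 'r::idom"
  assumes "\<And>i j. 1 \<le> i \<Longrightarrow> i < j \<Longrightarrow> j \<le> N \<Longrightarrow> M i j = 0"
  shows "det_on {1..N} M = (\<Prod>i=1..N. M i i)"
  using assms
proof (induction N)
  case (Suc N)
  have "det_on {1..Suc N} M = M (Suc N) (Suc N) * det_on ({1..Suc N} - {Suc N}) M"
    using Suc.prems by (intro det_on_remove_col) auto
  also have "{1..Suc N} - {Suc N} = {1..N}" by auto
  also have "det_on {1..N} M = (\<Prod>i=1..N. M i i)"
    using Suc by auto
  finally show ?case by (simp add: mult.commute)
qed simp

lemma det_on_one:
  fixes S :: "'i set"
  assumes "finite S"
  shows "det_on S (\<lambda>i j. if i = j then 1 else 0 :: 'r::idom) = 1"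
  using assms
proof (induction S rule: finite_induct)
  case (insert x S)
  let ?I = "\<lambda>i j. if i = j then 1 else 0 :: 'r"
  have "det_on (insert x S) ?I = ?I x x * det_on (insert x S - {x}) ?I"
    using insert by (intro det_on_remove_row) auto
  then show ?case using insert by simp
qed simp

lemma det_on_UN_blocks:
  fixes M :: "'i \<Rightarrow> 'i \<Rightarrow> 'r::idom"
  assumes "finite W" "\<And>w. w \<in> W \<Longrightarrow> finite (B w)"
    and "\<And>v w. v \<in> W \<Longrightarrow> w \<in> W \<Longrightarrow> v \<noteq> w \<Longrightarrow> B v \<inter> B w = {}"
    and "\<And>v w a b. v \<in> W \<Longrightarrow> w \<in> W \<Longrightarrow> v \<noteq> w \<Longrightarrow> a \<in> B v \<Longrightarrow> b \<in> B w \<Longrightarrow> M a b = 0"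
  shows "det_on (\<Union>w\<in>W. B w) M = (\<Prod>w\<in>W. det_on (B w) M)"
  using assms
proof (induction W rule: finite_induct)
  case (insert x W)
  have "det_on (B x \<union> (\<Union>w\<in>W. B w)) M = det_on (B x) M * det_on (\<Union>w\<in>W. B w) M"
    using insert.hyps insert.prems(1) insert.prems(2)[of x] insert.prems(3)[of x]
    by (intro det_on_block) (auto; blast)+
  also have "det_on (\<Union>w\<in>W. B w) M = (\<Prod>w\<in>W. det_on (B w) M)"
    using insert.prems(1,2) by (intro insert.IH) (auto intro: insert.prems(3))
  finally show ?case using insert.hyps by simp
qed simp

lemma det_on_row_add:
  assumes "finite S" "t \<in> S"
  shows "det_on S (\<lambda>i j. if i = t then u j + v j else M i j)
    = det_on S (\<lambda>i j. if i = t then u j else M i j) + det_on S (\<lambda>i j. if i = t then v j else M i j)"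
  unfolding det_on_def sum.distrib[symmetric]
proof (rule sum.cong[OF refl])
  fix p
  have "(\<Prod>i\<in>S - {t}. if i = t then w (p i) else M i (p i)) = (\<Prod>i\<in>S - {t}. M i (p i))" for w
    by (rule prod.cong) auto
  then show "of_int (sign p) * (\<Prod>i\<in>S. if i = t then u (p i) + v (p i) else M i (p i)) =
      of_int (sign p) * (\<Prod>i\<in>S. if i = t then u (p i) else M i (p i)) +
      of_int (sign p) * (\<Prod>i\<in>S. if i = t then v (p i) else M i (p i))"
    by (simp add: prod.remove[OF assms] algebra_simps)
qed

text \<open>
  For a matrix \<open>M\<close> with zero row sums and left null vector \<open>\<pi>\<close>, replacing row \<open>t\<close> of \<open>M + 1 c\<^sup>T\<close>
  by the \<open>\<pi>\<close>-combination of all rows leaves \<open>(\<Sum>\<pi>) c\<^sup>T\<close> there, which is then used to clear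
  the summand \<open>1 c\<^sup>T\<close>; adding all columns to column \<open>t\<close> finally isolates the minor.
\<close>

lemma det_on_rank_one:
  fixes M :: "'i \<Rightarrow> 'i \<Rightarrow> 'r::idom"
  assumes fin: "finite S" and t: "t \<in> S"
    and row: "\<And>i. i \<in> S \<Longrightarrow> (\<Sum>j\<in>S. M i j) = 0"
    and null: "\<And>j. j \<in> S \<Longrightarrow> (\<Sum>i\<in>S. \<pi> i * M i j) = 0"
    and c: "(\<Sum>j\<in>S. c j) = 1"
  shows "\<pi> t * det_on S (\<lambda>i j. M i j + c j) = (\<Sum>i\<in>S. \<pi> i) * det_on (S - {t}) M"
proof -
  let ?s = "\<Sum>i\<in>S. \<pi> i"
  \<comment> \<open>Nothing is inverted: the row operations are recorded as the product identity
    \<open>E (M + 1 c^T) = G L\<close>, and the column operation as \<open>L H\<close>.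
    \<open>G\<close> scales the new row \<open>t\<close>, which is \<open>c\<close>, and adds it
    back to all other rows.\<close>
  define E where "E i j = (if i = t then \<pi> j else if i = j then 1 else 0)" for i j
  define F where "F i j = (if i = j then 1 else if j = t then -1 else 0 :: 'r)" for i j
  define G where "G i j = (if i = t then (if j = t then ?s else 0) else if i = j then 1 else if j = t then 1 else 0)" for i j
  define H where "H i j = (if j = t then 1 else if i = j then 1 else 0 :: 'r)" for i j
  define L where "L i j = (if i = t then c j else M i j)" for i j
  have rem: "det_on (S - {t}) (\<lambda>i j. if i = j then 1 else 0 :: 'r) = 1"
    using fin by (intro det_on_one) auto
  have "det_on S E = E t t * det_on (S - {t}) E"
    using fin t by (intro det_on_remove_col) (auto simp: E_def)
  also have "det_on (S - {t}) E = det_on (S - {t}) (\<lambda>i j. if i = j then 1 else 0)"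
    by (rule det_on_cong) (auto simp: E_def)
  finally have detE: "det_on S E = \<pi> t" using rem by (simp add: E_def[of t t])
  have "det_on S G = G t t * det_on (S - {t}) G"
    using fin t by (intro det_on_remove_row) (auto simp: G_def)
  also have "det_on (S - {t}) G = det_on (S - {t}) (\<lambda>i j. if i = j then 1 else 0)"
    by (rule det_on_cong) (auto simp: G_def)
  finally have detG: "det_on S G = ?s" using rem by (simp add: G_def[of t t])
  have "det_on S H = H t t * det_on (S - {t}) H"
    using fin t by (intro det_on_remove_row) (auto simp: H_def)
  also have "det_on (S - {t}) H = det_on (S - {t}) (\<lambda>i j. if i = j then 1 else 0)"
    by (rule det_on_cong) (auto simp: H_def)
  finally have detH: "det_on S H = 1" using rem by (simp add: H_def[of t t])
  have "\<pi> t * det_on S (\<lambda>i j. M i j + c j)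
      = det_on S (\<lambda>i j. \<Sum>k\<in>S. E i k * (M k j + c j))"
    by (simp add: det_on_mult[OF fin] detE)
  also have "\<dots> = det_on S (\<lambda>i j. \<Sum>k\<in>S. G i k * L k j)"
  proof (rule det_on_cong[OF refl])
    fix i j assume ij: "i \<in> S" "j \<in> S"
    show "(\<Sum>k\<in>S. E i k * (M k j + c j)) = (\<Sum>k\<in>S. G i k * L k j)"
    proof (cases "i = t")
      case True
      have "(\<Sum>k\<in>S. G i k * L k j) = (\<Sum>k\<in>S. if k = t then ?s * c j else 0)"
        using True by (intro sum.cong) (auto simp: G_def L_def)
      moreover have "(\<Sum>k\<in>S. E i k * (M k j + c j)) = (\<Sum>k\<in>S. \<pi> k * M k j) + ?s * c j"
        using True by (simp add: E_def distrib_left sum.distrib sum_distrib_right)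
      ultimately show ?thesis using null[OF ij(2)] fin t by simp
    next
      case False
      have "(\<Sum>k\<in>S. E i k * (M k j + c j)) = (\<Sum>k\<in>S. if k = i then M i j + c j else 0)"
        using False by (intro sum.cong) (auto simp: E_def)
      moreover have "(\<Sum>k\<in>S. G i k * L k j)
          = (\<Sum>k\<in>S. (if k = i then M i j else 0) + (if k = t then c j else 0))"
        using False by (intro sum.cong) (auto simp: G_def L_def)
      ultimately show ?thesis using fin t ij by (simp add: sum.distrib)
    qed
  qed
  also have "\<dots> = ?s * det_on S L"
    by (simp add: det_on_mult[OF fin] detG)
  also have "det_on S L = det_on S (\<lambda>i j. \<Sum>k\<in>S. L i k * H k j)"
    by (simp add: det_on_mult[OF fin] detH)
  also have "\<dots> = det_on S (\<lambda>i j. if j = t then (if i = t then 1 else 0) else L i j)"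
  proof (rule det_on_cong[OF refl])
    fix i j assume ij: "i \<in> S" "j \<in> S"
    show "(\<Sum>k\<in>S. L i k * H k j) = (if j = t then (if i = t then 1 else 0) else L i j)"
    proof (cases "j = t")
      case True
      then show ?thesis using row[OF ij(1)] c by (simp add: H_def L_def)
    next
      case False
      then have "(\<Sum>k\<in>S. L i k * H k j) = (\<Sum>k\<in>S. if k = j then L i j else 0)"
        by (intro sum.cong) (auto simp: H_def)
      then show ?thesis using False fin ij by simp
    qed
  qed
  also have "\<dots> = det_on (S - {t}) (\<lambda>i j. if j = t then (if i = t then 1 else 0) else L i j)"
    using det_on_remove_col[OF fin t, of "\<lambda>i j. if j = t then (if i = t then 1 else 0) else L i j"]
    by simp
  also have "\<dots> = det_on (S - {t}) M"
    by (rule det_on_cong) (auto simp: L_def)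
  finally show ?thesis .
qed

section \<open>The ring and the chain on its trees\<close>

text \<open>Positions on the universal cover of the ring: with integer coordinates, wrap-around
  disappears from intervals and products. The shifts by one are due to the vertices starting at
  1.\<close>

definition ring_vertex :: "nat \<Rightarrow> int \<Rightarrow> nat" where
  "ring_vertex n z = nat ((z - 1) mod int n) + 1"

context
  fixes n :: nat
  assumes n3: "n \<ge> 3"
begin

lemma ring_vertex_in: "ring_vertex n z \<in> {1..n}"
proof -
  have "(z - 1) mod int n < int n" using n3 by (intro pos_mod_bound) auto
  moreover have "0 \<le> (z - 1) mod int n" using n3 by (intro pos_mod_sign) auto
  ultimately show ?thesis by (simp add: ring_vertex_def)
qed

lemma ring_vertex_bounds [simp]:
  "Suc 0 \<le> ring_vertex n z" "ring_vertex n z \<le> n" "0 < ring_vertex n z" "ring_vertex n z \<noteq> 0"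
  using ring_vertex_in[of z] by auto

lemma ring_vertex_of_nat: "i \<in> {1..n} \<Longrightarrow> ring_vertex n (int i) = i"
  by (auto simp: ring_vertex_def)

lemma ring_vertex_eq_iff: "ring_vertex n x = ring_vertex n y \<longleftrightarrow> int n dvd x - y"
proof -
  have "0 \<le> (z - 1) mod int n" for z using n3 by (intro pos_mod_sign) auto
  then have "ring_vertex n x = ring_vertex n y \<longleftrightarrow> (x - 1) mod int n = (y - 1) mod int n"
    unfolding ring_vertex_def by (metis add_right_cancel eq_nat_nat_iff)
  then show ?thesis by (simp add: mod_eq_dvd_iff)
qed

lemma int_multiple_small: "int n dvd z \<Longrightarrow> \<bar>z\<bar> < int n \<Longrightarrow> z = 0"
  using dvd_imp_le_int[of z "int n"] by (cases "z = 0") auto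

text \<open>Most later comparisons of vertices take place in a window of fewer than \<open>n\<close>
  steps, where they become linear integer arithmetic.\<close>

lemma ring_vertex_eq_small:
  "\<bar>x - y\<bar> < int n \<Longrightarrow> ring_vertex n x = ring_vertex n y \<longleftrightarrow> x = y"
  using int_multiple_small[of "x - y"] by (auto simp: ring_vertex_eq_iff)

lemma ring_vertex_add_n [simp]: "ring_vertex n (x + int n) = ring_vertex n x"
  by (simp add: ring_vertex_eq_iff)

lemma ring_vertex_diff_n [simp]: "ring_vertex n (x - int n) = ring_vertex n x"
  by (simp add: ring_vertex_eq_iff)

lemma int_ring_vertex:
  assumes "i \<in> {1..n}" shows "ring_vertex n x = i \<longleftrightarrow> int n dvd x - int i"
  using ring_vertex_eq_iff[of x "int i"] ring_vertex_of_nat[OF assms] by simp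

lemma ring_vertex_int_cong: "ring_vertex n (int (ring_vertex n x) + y) = ring_vertex n (x + y)"
proof -
  have "ring_vertex n (int (ring_vertex n x)) = ring_vertex n x"
    by (rule ring_vertex_of_nat) (rule ring_vertex_in)
  then have "int n dvd int (ring_vertex n x) - x" by (simp only: ring_vertex_eq_iff)
  then show ?thesis by (simp add: ring_vertex_eq_iff)
qed

lemma ring_succ_vertex [simp]: "ring_succ n (ring_vertex n x) = ring_vertex n (x + 1)"
proof (cases "ring_vertex n x = n")
  case True
  then have "ring_vertex n x = ring_vertex n (int n)"
    using ring_vertex_of_nat[of n] n3 by simp
  then have "int n dvd x - int n" by (simp only: ring_vertex_eq_iff)
  from dvd_add[OF this dvd_refl] have "int n dvd x" by simp
  then have "ring_vertex n (x + 1) = ring_vertex n 1" by (simp add: ring_vertex_eq_iff)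
  also have "\<dots> = 1" by (simp add: ring_vertex_def)
  finally show ?thesis using True by (simp add: ring_succ_def)
next
  case False
  let ?i = "ring_vertex n x"
  have "?i < n" using False ring_vertex_bounds(2)[of x] by linarith
  then have i: "?i + 1 \<in> {1..n}" by simp
  have "?i + 1 = ring_vertex n (int (?i + 1))" using ring_vertex_of_nat[OF i] by simp
  also have "\<dots> = ring_vertex n (x + 1)"
    using ring_vertex_int_cong[of x 1] by (simp add: add.commute)
  finally show ?thesis using False by (simp add: ring_succ_def)
qed

lemma ring_pred_succ: "i \<in> {1..n} \<Longrightarrow> ring_pred n (ring_succ n i) = i"
  by (auto simp: ring_pred_def ring_succ_def)

lemma ring_succ_pred: "i \<in> {1..n} \<Longrightarrow> ring_succ n (ring_pred n i) = i"
  by (auto simp: ring_pred_def ring_succ_def)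

lemma ring_pred_vertex [simp]: "ring_pred n (ring_vertex n x) = ring_vertex n (x - 1)"
  using ring_pred_succ[OF ring_vertex_in[of "x - 1"]] by simp

lemma ring_succ_conv: "i \<in> {1..n} \<Longrightarrow> ring_succ n i = ring_vertex n (int i + 1)"
  using ring_succ_vertex[of "int i"] ring_vertex_of_nat[of i] by simp

lemma ring_pred_conv: "i \<in> {1..n} \<Longrightarrow> ring_pred n i = ring_vertex n (int i - 1)"
  using ring_pred_vertex[of "int i"] ring_vertex_of_nat[of i] by simp

lemma ring_succ_in: "i \<in> {1..n} \<Longrightarrow> ring_succ n i \<in> {1..n}"
  by (simp only: ring_succ_conv ring_vertex_in)

lemma ring_pred_in: "i \<in> {1..n} \<Longrightarrow> ring_pred n i \<in> {1..n}"
  by (simp only: ring_pred_conv ring_vertex_in)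

lemma ring_succ_eq_iff:
  "i \<in> {1..n} \<Longrightarrow> j \<in> {1..n} \<Longrightarrow> ring_succ n i = j \<longleftrightarrow> i = ring_pred n j"
  by (metis ring_pred_succ ring_succ_pred)

lemma ring_pred_eq_iff:
  "i \<in> {1..n} \<Longrightarrow> j \<in> {1..n} \<Longrightarrow> ring_pred n i = j \<longleftrightarrow> i = ring_succ n j"
  by (metis ring_pred_succ ring_succ_pred)

text \<open>The ring cut open at \<open>w\<close> is a path; numbering its vertices by their forward
  distance from \<open>w\<close> is what makes the minor of \<open>ring_lap\<close>
  tridiagonal.\<close>

lemma bij_betw_ring_vertex:
  assumes w: "w \<in> {1..n}"
  shows "bij_betw (\<lambda>a. ring_vertex n (int w + int a)) {1..n-1} ({1..n} - {w})"
proof (rule bij_betw_imageI)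
  show "inj_on (\<lambda>a. ring_vertex n (int w + int a)) {1..n-1}"
  proof (rule inj_onI)
    fix a b assume *: "a \<in> {1..n-1}" "b \<in> {1..n-1}"
      "ring_vertex n (int w + int a) = ring_vertex n (int w + int b)"
    then have "int n dvd int a - int b" by (simp add: ring_vertex_eq_iff)
    then have "int a - int b = 0" using * by (intro int_multiple_small) auto
    then show "a = b" by simp
  qed
  show "(\<lambda>a. ring_vertex n (int w + int a)) ` {1..n-1} = {1..n} - {w}"
  proof (intro equalityI subsetI)
    fix v assume "v \<in> (\<lambda>a. ring_vertex n (int w + int a)) ` {1..n-1}"
    then obtain a where a: "a \<in> {1..n-1}" "v = ring_vertex n (int w + int a)" by auto
    have "v \<noteq> w"
    proof
      assume "v = w"
      then have "int n dvd int a" using int_ring_vertex[OF w] a by simp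
      then have "int a = 0" using a by (intro int_multiple_small) auto
      with a show False by simp
    qed
    then show "v \<in> {1..n} - {w}" using a(2) ring_vertex_in by blast
  next
    fix v assume v: "v \<in> {1..n} - {w}"
    define a where "a = (if v > w then v - w else v + n - w)"
    have "a \<in> {1..n-1}" using v w by (auto simp: a_def)
    moreover have "ring_vertex n (int w + int a) = v"
      using v w int_ring_vertex[of v] by (auto simp: a_def of_nat_diff)
    ultimately show "v \<in> (\<lambda>a. ring_vertex n (int w + int a)) ` {1..n-1}" by force
  qed
qed

end

text \<open>
  State \<open>(i, a)\<close> encodes the tree with root \<open>i\<close> whose arcs point forwards out of \<open>i - a, \<dots>, i - 1\<close>
  and backwards out of \<open>i + 1, \<dots>, i + n - 1 - a\<close>.
\<close>

definition tree_states :: "nat \<Rightarrow> (nat \<times> nat) set" where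
  "tree_states n = {1..n} \<times> {0..<n}"

text \<open>At \<open>a = n - 1\<close> all arcs point forwards, so the step adds one forward arc
  and removes another: hence the \<open>min\<close>. In \<open>state_down\<close> the subtraction of
  natural numbers has the same effect at \<open>a = 0\<close>.\<close>

definition state_up :: "nat \<Rightarrow> nat \<times> nat \<Rightarrow> nat \<times> nat" where
  "state_up n s = (ring_succ n (fst s), min (snd s + 1) (n - 1))"

definition state_down :: "nat \<Rightarrow> nat \<times> nat \<Rightarrow> nat \<times> nat" where
  "state_down n s = (ring_pred n (fst s), snd s - 1)"

text \<open>This is -R in state coordinates, for arbitrary forward rates \<open>p\<close> and
  backward rates \<open>m\<close>, as \<open>ring_lap\<close> is -Q. Separate indicators for the
  jumps let sums over rows and fibres collapse term by term.\<close>

definition state_lap ::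
  "nat \<Rightarrow> (nat \<Rightarrow> 'r::idom) \<Rightarrow> (nat \<Rightarrow> 'r) \<Rightarrow> nat \<times> nat \<Rightarrow> nat \<times> nat \<Rightarrow> 'r" where
  "state_lap n p m s t = (if s = t then p (fst s) + m (fst s) else 0)
     - (if state_up n s = t then p (fst s) else 0) - (if state_down n s = t then m (fst s) else 0)"

definition ring_lap :: "nat \<Rightarrow> (nat \<Rightarrow> 'r::idom) \<Rightarrow> (nat \<Rightarrow> 'r) \<Rightarrow> nat \<Rightarrow> nat \<Rightarrow> 'r" where
  "ring_lap n p m i j = (if i = j then p i + m i else 0)
     - (if ring_succ n i = j then p i else 0) - (if ring_pred n i = j then m i else 0)"

text \<open>Integer arguments let the root pass from \<open>n\<close> to 1 without case distinctions
  in the balance identities.\<close>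

definition path_weight ::
  "nat \<Rightarrow> (nat \<Rightarrow> 'r::idom) \<Rightarrow> (nat \<Rightarrow> 'r) \<Rightarrow> int \<Rightarrow> int \<Rightarrow> 'r" where
  "path_weight n p m i a = (\<Prod>x\<in>{i - a..i - 1}. p (ring_vertex n x)) *
     (\<Prod>x\<in>{i + 1..i + int n - 1 - a}. m (ring_vertex n x))"

definition state_weight ::
  "nat \<Rightarrow> (nat \<Rightarrow> 'r::idom) \<Rightarrow> (nat \<Rightarrow> 'r) \<Rightarrow> nat \<times> nat \<Rightarrow> 'r" where
  "state_weight n p m s = path_weight n p m (int (fst s)) (int (snd s))"

section \<open>Determinant of a walk on a path that is killed at both ends\<close>

definition tridiag :: "(nat \<Rightarrow> 'r::idom) \<Rightarrow> (nat \<Rightarrow> 'r) \<Rightarrow> nat \<Rightarrow> nat \<Rightarrow> 'r" where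
  "tridiag p m i j = (if i = j then p i + m i else 0)
     - (if j = i + 1 then p i else 0) - (if i = j + 1 then m i else 0)"

text \<open>The last row splits into the killing at the right end, which leaves the smaller
  determinant, and a row without that killing. In the second matrix the walk can be lost at the left
  end only, and the determinant is the product of the \<open>m i\<close>.\<close>

lemma det_tridiag_step:
  "det_on {1..Suc N} (tridiag p m) = p (Suc N) * det_on {1..N} (tridiag p m) + (\<Prod>i=1..Suc N. m i)"
proof -
  let ?N = "Suc N"
  let ?u = "\<lambda>j. if j = ?N then p ?N else 0"
  let ?v = "\<lambda>j. (if j = ?N then m ?N else 0) - (if ?N = j + 1 then m ?N else 0)"
  define L where "L i j = (if i = ?N then ?v j else tridiag p m i j)" for i j
  \<comment> \<open>Right multiplication by \<open>U\<close> replaces each row by its tail sums.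
    Those of row \<open>i\<close> of \<open>L\<close> that start left of the diagonal are full row
    sums and vanish; the one that starts at the diagonal is \<open>m i\<close>. So
    \<open>L U\<close> is upper triangular.\<close>
  define U where "U k j = (if j \<le> k then 1 else 0 :: 'a)" for k j :: nat
  have LU_sum: "(\<Sum>k\<in>{1..?N}. L i k * U k j) = (if j = i then m i else 0)"
    if "1 \<le> j" "j \<le> i" "i \<le> ?N" for i j
  proof -
    have "(\<Sum>k\<in>{1..?N}. L i k * U k j) =
        (\<Sum>k\<in>{1..?N}. (if k = i then (if i = ?N then m i else p i + m i) else 0)
          - (if k = i + 1 then (if i = ?N then 0 else p i) else 0)
          - (if k = i - 1 then (if j \<le> i - 1 then m i else 0) else 0))"
      using that by (intro sum.cong) (auto simp: L_def U_def tridiag_def)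
    also have "\<dots> = (if j = i then m i else 0)"
      using that by (auto simp: sum_subtractf simp del: sum.cl_ivl_Suc)
    finally show ?thesis .
  qed
  have "det_on {1..?N} (tridiag p m)
      = det_on {1..?N} (\<lambda>i j. if i = ?N then ?u j + ?v j else tridiag p m i j)"
    by (rule det_on_cong) (auto simp: tridiag_def)
  also have "\<dots> = det_on {1..?N} (\<lambda>i j. if i = ?N then ?u j else tridiag p m i j) + det_on {1..?N} L"
    unfolding L_def by (rule det_on_row_add) auto
  also have "det_on {1..?N} (\<lambda>i j. if i = ?N then ?u j else tridiag p m i j)
      = p ?N * det_on ({1..?N} - {?N}) (\<lambda>i j. if i = ?N then ?u j else tridiag p m i j)"
    by (subst det_on_remove_row[of _ ?N]) auto
  also have "det_on ({1..?N} - {?N}) (\<lambda>i j. if i = ?N then ?u j else tridiag p m i j)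
      = det_on {1..N} (tridiag p m)"
    by (rule det_on_cong) auto
  also have "det_on {1..?N} L = (\<Prod>i=1..?N. m i)"
  proof -
    have "det_on {1..?N} U = (\<Prod>i=1..?N. U i i)"
      by (rule det_on_lower_triangular) (auto simp: U_def)
    also have "\<dots> = 1" by (simp add: U_def del: prod.cl_ivl_Suc)
    finally have "det_on {1..?N} U = 1" .
    then have "det_on {1..?N} L = det_on {1..?N} (\<lambda>i j. \<Sum>k\<in>{1..?N}. L i k * U k j)"
      using det_on_mult[of "{1..?N}" L U] by (simp del: sum.cl_ivl_Suc)
    also have "\<dots> = (\<Prod>i=1..?N. \<Sum>k\<in>{1..?N}. L i k * U k i)"
    proof (rule det_on_upper_triangular)
      fix i j :: nat assume ij: "1 \<le> j" "j < i" "i \<le> ?N"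
      show "(\<Sum>k\<in>{1..?N}. L i k * U k j) = 0"
        using ij by (simp only: LU_sum) auto
    qed
    also have "\<dots> = (\<Prod>i=1..?N. m i)"
    proof (rule prod.cong[OF refl])
      fix i assume "i \<in> {1..?N}"
      then show "(\<Sum>k\<in>{1..?N}. L i k * U k i) = m i"
        using LU_sum[of i i] by (simp del: sum.cl_ivl_Suc)
    qed
    finally show ?thesis .
  qed
  finally show ?thesis .
qed

text \<open>Term \<open>k\<close> belongs to the orientation of the path in which the first
  \<open>k\<close> vertices drain to the left end and the others to the right end. On the ring both
  ends are the deleted vertex, and the orientation is a tree rooted there.\<close>

lemma det_tridiag:
  "det_on {1..N} (tridiag p m) = (\<Sum>k=0..N. (\<Prod>i=1..k. m i) * (\<Prod>i=k+1..N. p i))"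
proof (induction N)
  case (Suc N)
  have "(\<Sum>k=0..N. (\<Prod>i=1..k. m i) * (\<Prod>i=k+1..Suc N. p i))
      = p (Suc N) * (\<Sum>k=0..N. (\<Prod>i=1..k. m i) * (\<Prod>i=k+1..N. p i))"
    by (simp add: sum_distrib_left mult_ac)
  then show ?case using det_tridiag_step[of N p m] Suc by simp
qed simp

section \<open>Tree weights as invariant measure, and the minors of the ring Laplacian\<close>

context
  fixes n :: nat
  assumes n3: "n \<ge> 3"
begin

lemma path_weight_periodic:
  assumes "int n dvd i - i'"
  shows "path_weight n p m i a = path_weight n p m i' a"
proof -
  let ?d = "i - i'"
  have r: "ring_vertex n (x + ?d) = ring_vertex n x" "ring_vertex n (x - ?d) = ring_vertex n x" for x
    using assms dvd_diff_commute[of "int n" i i'] by (simp_all add: ring_vertex_eq_iff[OF n3])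
  have "(\<Prod>x\<in>{i - a..i - 1}. p (ring_vertex n x)) = (\<Prod>x\<in>{i' - a..i' - 1}. p (ring_vertex n x))"
    by (rule prod.reindex_bij_witness[where i = "\<lambda>x. x + ?d" and j = "\<lambda>x. x - ?d"]) (auto simp: r)
  moreover have "(\<Prod>x\<in>{i + 1..i + int n - 1 - a}. m (ring_vertex n x))
      = (\<Prod>x\<in>{i' + 1..i' + int n - 1 - a}. m (ring_vertex n x))"
    by (rule prod.reindex_bij_witness[where i = "\<lambda>x. x + ?d" and j = "\<lambda>x. x - ?d"]) (auto simp: r)
  ultimately show ?thesis by (simp add: path_weight_def)
qed

text \<open>Both sides are products over the same \<open>n\<close> arcs, one out of each vertex: a
  tree together with an arc out of its root closes exactly one cycle. Here and in
  \<open>path_weight_down\<close> the cycle is a pair of opposite arcs, in the two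
  \<open>last\<close> variants it is the whole ring.\<close>

lemma path_weight_up:
  assumes "1 \<le> b" "b < int n"
  shows "path_weight n p m (j - 1) (b - 1) * p (ring_vertex n (j - 1))
    = path_weight n p m j b * m (ring_vertex n j)"
proof -
  have "{j - b..j - 1} = insert (j - 1) {j - b..j - 2}" using assms by auto
  moreover have "{j..j + int n - 1 - b} = insert j {j + 1..j + int n - 1 - b}" using assms by auto
  ultimately show ?thesis by (simp add: path_weight_def algebra_simps)
qed

lemma path_weight_up_last:
  "path_weight n p m (j - 1) (int n - 1) * p (ring_vertex n (j - 1))
    = path_weight n p m j (int n - 1) * p (ring_vertex n j)"
proof -
  let ?f = "\<lambda>x. p (ring_vertex n x)"
  have "{j - int n..j - 1} = insert (j - 1) {j - int n..j - 2}" using n3 by auto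
  then have "prod ?f {j - int n..j - 1} = ?f (j - 1) * prod ?f {j - int n..j - 2}" by simp
  moreover have "{j - int n..j - 1} = insert (j - int n) {j - int n + 1..j - 1}" using n3 by auto
  then have "prod ?f {j - int n..j - 1} = ?f j * prod ?f {j - int n + 1..j - 1}"
    by (simp add: ring_vertex_diff_n[OF n3])
  ultimately show ?thesis by (simp add: path_weight_def algebra_simps)
qed

lemma path_weight_down:
  assumes "0 \<le> b" "b \<le> int n - 2"
  shows "path_weight n p m (j + 1) (b + 1) * m (ring_vertex n (j + 1))
    = path_weight n p m j b * p (ring_vertex n j)"
proof -
  have "{j - b..j} = insert j {j - b..j - 1}" using assms by auto
  moreover have "{j + 1..j + int n - 1 - b} = insert (j + 1) {j + 2..j + int n - 1 - b}"
    using assms by auto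
  ultimately show ?thesis by (simp add: path_weight_def algebra_simps)
qed

lemma path_weight_down_last:
  "path_weight n p m (j + 1) 0 * m (ring_vertex n (j + 1))
    = path_weight n p m j 0 * m (ring_vertex n j)"
proof -
  let ?f = "\<lambda>x. m (ring_vertex n x)"
  have "{j + 1..j + int n} = insert (j + 1) {j + 2..j + int n}" using n3 by auto
  then have "prod ?f {j + 1..j + int n} = ?f (j + 1) * prod ?f {j + 2..j + int n}" by simp
  moreover have "{j + 1..j + int n} = insert (j + int n) {j + 1..j + int n - 1}" using n3 by auto
  then have "prod ?f {j + 1..j + int n} = ?f j * prod ?f {j + 1..j + int n - 1}"
    by (simp add: ring_vertex_add_n[OF n3])
  ultimately show ?thesis by (simp add: path_weight_def algebra_simps)
qed

lemma state_weight_vertex: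
  "state_weight n p m (ring_vertex n x, a) = path_weight n p m x (int a)"
proof -
  have "int n dvd int (ring_vertex n x) - x"
    using ring_vertex_int_cong[OF n3, of x 0] by (simp add: ring_vertex_eq_iff[OF n3])
  then show ?thesis by (simp add: state_weight_def path_weight_periodic)
qed

lemma state_up_in: "s \<in> tree_states n \<Longrightarrow> state_up n s \<in> tree_states n"
  using ring_succ_in[OF n3, of "fst s"] n3 by (auto simp: tree_states_def state_up_def)

lemma state_down_in: "s \<in> tree_states n \<Longrightarrow> state_down n s \<in> tree_states n"
  using ring_pred_in[OF n3, of "fst s"] by (auto simp: tree_states_def state_down_def)

lemma finite_tree_states [simp]: "finite (tree_states n)"
  by (simp add: tree_states_def)

lemma state_lap_row_sum:
  "s \<in> tree_states n \<Longrightarrow> (\<Sum>t\<in>tree_states n. state_lap n p m s t) = 0"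
  using state_up_in[of s] state_down_in[of s]
  by (simp add: state_lap_def sum_subtractf)

lemma ring_lap_row_sum:
  "i \<in> {1..n} \<Longrightarrow> (\<Sum>j\<in>{1..n}. ring_lap n p m i j) = 0"
  using ring_succ_in[OF n3, of i] ring_pred_in[OF n3, of i]
  by (simp add: ring_lap_def sum_subtractf)

text \<open>Inflow equals outflow, which is \<open>p j + m j\<close> times the weight. For inner
  \<open>b\<close> the jump up brings in \<open>m j\<close> and the jump down \<open>p j\<close>; at
  \<open>b = n - 1\<close> the two jumps up that truncation merges bring in both terms, and at
  \<open>b = 0\<close> the two jumps down do.\<close>

lemma state_weight_null:
  assumes t: "t \<in> tree_states n"
  shows "(\<Sum>s\<in>tree_states n. state_weight n p m s * state_lap n p m s t) = 0"
proof -
  obtain j b where tjb: "t = (j, b)" by (cases t)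
  have j: "j \<in> {1..n}" and b: "b < n" using t by (auto simp: tree_states_def tjb)
  let ?S = "tree_states n" and ?w = "state_weight n p m"
  have rj: "ring_vertex n (int j) = j" using j by (rule ring_vertex_of_nat[OF n3])
  have pj: "ring_pred n j = ring_vertex n (int j - 1)" using j by (rule ring_pred_conv[OF n3])
  have sj: "ring_succ n j = ring_vertex n (int j + 1)" using j by (rule ring_succ_conv[OF n3])
  have wt: "?w (j, c) = path_weight n p m (int j) (int c)" for c
    by (simp add: state_weight_def)
  have w1: "?w (ring_pred n j, b - 1) * p (ring_pred n j) = ?w t * m j" if "b \<ge> 1"
    using path_weight_up[of "int b" p m "int j"] b that
    by (simp add: pj tjb wt state_weight_vertex rj of_nat_diff)
  have w2: "?w (ring_pred n j, n - 1) * p (ring_pred n j) = ?w t * p j" if "b = n - 1"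
    using path_weight_up_last[of p m "int j"] n3 that
    by (simp add: pj tjb wt state_weight_vertex rj of_nat_diff)
  have w3: "?w (ring_succ n j, b + 1) * m (ring_succ n j) = ?w t * p j" if "b < n - 1"
    using path_weight_down[of "int b" p m "int j"] that
    by (simp add: sj tjb wt state_weight_vertex rj of_nat_diff add.commute)
  have w4: "?w (ring_succ n j, 0) * m (ring_succ n j) = ?w t * m j" if "b = 0"
    using path_weight_down_last[of p m "int j"] that
    by (simp add: sj tjb wt state_weight_vertex rj)
  have up_iff: "state_up n (i, a) = t \<longleftrightarrow> i = ring_pred n j \<and> min (a + 1) (n - 1) = b" if "i \<in> {1..n}" for i a
    using ring_succ_eq_iff[OF n3 that j] by (simp add: state_up_def tjb)
  have "{s \<in> ?S. state_up n s = t} = {s \<in> ?S. fst s = ring_pred n j \<and> min (snd s + 1) (n - 1) = b}"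
    by (rule Collect_cong) (use up_iff in \<open>force simp: tree_states_def\<close>)
  also have "\<dots> = (if b \<ge> 1 then {(ring_pred n j, b - 1)} else {}) \<union> (if b = n - 1 then {(ring_pred n j, n - 1)} else {})"
    using ring_pred_in[OF n3 j] b n3
    by (auto simp: tree_states_def min_def split: if_splits)
  finally have "(\<Sum>s\<in>{s \<in> ?S. state_up n s = t}. ?w s * p (fst s))
      = (if b \<ge> 1 then ?w t * m j else 0) + (if b = n - 1 then ?w t * p j else 0)"
    using w1 w2 n3 by auto
  then have U: "(\<Sum>s\<in>?S. if state_up n s = t then ?w s * p (fst s) else 0)
      = (if b \<ge> 1 then ?w t * m j else 0) + (if b = n - 1 then ?w t * p j else 0)"
    by (simp add: sum.inter_filter)
  have down_iff: "state_down n (i, a) = t \<longleftrightarrow> i = ring_succ n j \<and> a - 1 = b" if "i \<in> {1..n}" for i a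
    using ring_pred_eq_iff[OF n3 that j] by (simp add: state_down_def tjb)
  have "{s \<in> ?S. state_down n s = t} = {s \<in> ?S. fst s = ring_succ n j \<and> snd s - 1 = b}"
    by (rule Collect_cong) (use down_iff in \<open>force simp: tree_states_def\<close>)
  also have "\<dots> = (if b < n - 1 then {(ring_succ n j, b + 1)} else {}) \<union> (if b = 0 then {(ring_succ n j, 0)} else {})"
    using ring_succ_in[OF n3 j] b n3
    by (auto simp: tree_states_def split: if_splits)
  finally have "(\<Sum>s\<in>{s \<in> ?S. state_down n s = t}. ?w s * m (fst s))
      = (if b < n - 1 then ?w t * p j else 0) + (if b = 0 then ?w t * m j else 0)"
    using w3 w4 n3 by auto
  then have D: "(\<Sum>s\<in>?S. if state_down n s = t then ?w s * m (fst s) else 0)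
      = (if b < n - 1 then ?w t * p j else 0) + (if b = 0 then ?w t * m j else 0)"
    by (simp add: sum.inter_filter)
  have "(\<Sum>s\<in>?S. ?w s * state_lap n p m s t)
      = (\<Sum>s\<in>?S. (if s = t then ?w t * (p j + m j) else 0)
          - (if state_up n s = t then ?w s * p (fst s) else 0)
          - (if state_down n s = t then ?w s * m (fst s) else 0))"
    by (rule sum.cong) (auto simp: state_lap_def tjb algebra_simps)
  also have "\<dots> = ?w t * (p j + m j)
      - ((if b \<ge> 1 then ?w t * m j else 0) + (if b = n - 1 then ?w t * p j else 0))
      - ((if b < n - 1 then ?w t * p j else 0) + (if b = 0 then ?w t * m j else 0))"
    unfolding sum_subtractf U D using t by simp
  also have "\<dots> = 0" using b n3 by (auto simp: algebra_simps)
  finally show ?thesis .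
qed

text \<open>Lumpability: the jump rates of the root do not depend on \<open>a\<close>. Hence summing
  \<open>state_weight\<close> over the fibres yields a left null vector of \<open>ring_lap\<close>,
  namely \<open>root_weight\<close>.\<close>

lemma state_lap_fibre_sum:
  assumes "i \<in> {1..n}" "a < n"
  shows "(\<Sum>b=0..<n. state_lap n p m (i, a) (j, b)) = ring_lap n p m i j"
proof -
  have "(\<Sum>b=0..<n. state_lap n p m (i, a) (j, b))
      = (\<Sum>b=0..<n. (if b = a then (if i = j then p i + m i else 0) else 0)
          - (if b = min (a + 1) (n - 1) then (if ring_succ n i = j then p i else 0) else 0)
          - (if b = a - 1 then (if ring_pred n i = j then m i else 0) else 0))"
    by (rule sum.cong) (auto simp: state_lap_def state_up_def state_down_def)
  also have "\<dots> = ring_lap n p m i j"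
  proof -
    have "min (a + 1) (n - 1) < n" "a - 1 < n" using assms n3 by auto
    then show ?thesis using assms by (simp add: sum_subtractf ring_lap_def)
  qed
  finally show ?thesis .
qed

definition root_weight :: "(nat \<Rightarrow> 'r::idom) \<Rightarrow> (nat \<Rightarrow> 'r) \<Rightarrow> nat \<Rightarrow> 'r" where
  "root_weight p m i = (\<Sum>a=0..<n. state_weight n p m (i, a))"

lemma root_weight_null:
  assumes j: "j \<in> {1..n}"
  shows "(\<Sum>i\<in>{1..n}. root_weight p m i * ring_lap n p m i j) = 0"
proof -
  have "(\<Sum>i\<in>{1..n}. root_weight p m i * ring_lap n p m i j)
      = (\<Sum>i\<in>{1..n}. \<Sum>a\<in>{0..<n}. \<Sum>b\<in>{0..<n}. state_weight n p m (i, a) * state_lap n p m (i, a) (j, b))"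
    unfolding root_weight_def sum_distrib_right
    by (intro sum.cong refl) (simp add: state_lap_fibre_sum[symmetric] sum_distrib_left)
  also have "\<dots> = (\<Sum>s\<in>tree_states n. \<Sum>b\<in>{0..<n}. state_weight n p m s * state_lap n p m s (j, b))"
    by (subst sum.cartesian_product) (simp add: tree_states_def case_prod_unfold)
  also have "\<dots> = (\<Sum>b\<in>{0..<n}. \<Sum>s\<in>tree_states n. state_weight n p m s * state_lap n p m s (j, b))"
    by (rule sum.swap)
  also have "\<dots> = 0"
    using j by (intro sum.neutral ballI state_weight_null) (auto simp: tree_states_def)
  finally show ?thesis .
qed

text \<open>Positions \<open>0\<close> and \<open>n\<close> both name \<open>w\<close>, so a jump
  into the deleted vertex matches no \<open>b\<close> in the range and becomes killing at an end of
  the path.\<close>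

lemma det_ring_lap_minor_tridiag:
  assumes w: "w \<in> {1..n}"
  shows "det_on ({1..n} - {w}) (ring_lap n p m)
    = det_on {1..n-1} (tridiag (\<lambda>a. p (ring_vertex n (int w + int a))) (\<lambda>a. m (ring_vertex n (int w + int a))))"
proof -
  let ?r = "\<lambda>a. ring_vertex n (int w + int a)"
  have "det_on ({1..n} - {w}) (ring_lap n p m)
      = det_on {1..n-1} (\<lambda>a b. ring_lap n p m (?r a) (?r b))"
    by (rule det_on_reindex[OF bij_betw_ring_vertex[OF n3 w]]) simp
  also have "\<dots> = det_on {1..n-1} (tridiag (\<lambda>a. p (?r a)) (\<lambda>a. m (?r a)))"
  proof (rule det_on_cong[OF refl])
    fix a b assume ab: "a \<in> {1..n-1}" "b \<in> {1..n-1}"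
    have "?r a = ?r b \<longleftrightarrow> a = b"
      using ab by (subst ring_vertex_eq_small[OF n3]) auto
    moreover have "ring_vertex n (int w + int a + 1) = ?r b \<longleftrightarrow> b = a + 1"
      using ab by (subst ring_vertex_eq_small[OF n3]) auto
    moreover have "ring_vertex n (int w + int a - 1) = ?r b \<longleftrightarrow> a = b + 1"
      using ab by (subst ring_vertex_eq_small[OF n3]) auto
    ultimately show "ring_lap n p m (?r a) (?r b) = tridiag (\<lambda>a. p (?r a)) (\<lambda>a. m (?r a)) a b"
      by (simp add: ring_lap_def tridiag_def ring_succ_vertex[OF n3] ring_pred_vertex[OF n3])
  qed
  finally show ?thesis .
qed

text \<open>Here \<open>k\<close> counts the backward arcs. Going forwards from the root
  \<open>w\<close>, these come first; the forward arcs, which \<open>path_weight\<close> places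
  before the root, are moved on by \<open>n\<close> to the positions from \<open>k + 1\<close> to
  \<open>n - 1\<close>.\<close>

lemma state_weight_product:
  assumes k: "k < n"
  shows "state_weight n p m (w, n - 1 - k)
    = (\<Prod>c=1..k. m (ring_vertex n (int w + int c))) * (\<Prod>c=k+1..n-1. p (ring_vertex n (int w + int c)))"
proof -
  have "(\<Prod>c=1..k. m (ring_vertex n (int w + int c)))
      = (\<Prod>x\<in>{int w + 1..int w + int k}. m (ring_vertex n x))"
    by (rule prod.reindex_bij_witness[where i = "\<lambda>x. nat (x - int w)" and j = "\<lambda>x. int w + int x"]) auto
  moreover have "(\<Prod>c=k+1..n-1. p (ring_vertex n (int w + int c)))
      = (\<Prod>x\<in>{int w - (int n - 1 - int k)..int w - 1}. p (ring_vertex n x))"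
    by (rule prod.reindex_bij_witness[where i = "\<lambda>x. nat (x - int w + int n)"
          and j = "\<lambda>x. int w + int x - int n"]) (use n3 in \<open>auto simp: ring_vertex_diff_n[OF n3]\<close>)
  moreover have "int (n - 1 - k) = int n - 1 - int k" using k n3 by auto
  moreover have "int w + int n - 1 - (int n - 1 - int k) = int w + int k" by simp
  ultimately show ?thesis
    by (simp only: state_weight_def path_weight_def fst_conv snd_conv mult.commute)
qed

text \<open>The matrix-tree theorem for the ring: the terms of \<open>det_tridiag\<close> are the
  weights of the trees rooted at \<open>w\<close>, sorted by the number of backward arcs.\<close>

lemma det_ring_lap_minor:
  assumes w: "w \<in> {1..n}"
  shows "det_on ({1..n} - {w}) (ring_lap n p m) = root_weight p m w"
proof -
  let ?r = "\<lambda>a. ring_vertex n (int w + int a)"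
  have "det_on ({1..n} - {w}) (ring_lap n p m)
      = (\<Sum>k=0..n-1. (\<Prod>i=1..k. m (?r i)) * (\<Prod>i=k+1..n-1. p (?r i)))"
    unfolding det_ring_lap_minor_tridiag[OF w] det_tridiag ..
  also have "\<dots> = (\<Sum>k=0..n-1. state_weight n p m (w, n - 1 - k))"
    using n3 by (intro sum.cong refl state_weight_product[symmetric]) auto
  also have "\<dots> = (\<Sum>a=0..<n. state_weight n p m (w, a))"
    by (rule sum.reindex_bij_witness[where i = "\<lambda>a. n - 1 - a" and j = "\<lambda>k. n - 1 - k"])
      (use n3 in auto)
  finally show ?thesis by (simp add: root_weight_def)
qed

end

section \<open>Factorization of the perturbed determinant and passage to minors\<close>

context
  fixes n :: nat
  assumes n3: "n \<ge> 3"
begin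

lemma sum_difference_row:
  fixes X :: "nat \<times> nat \<Rightarrow> 'r::idom"
  assumes "s \<in> tree_states n"
  shows "(\<Sum>u\<in>tree_states n. ((if u = s then 1 else 0) - (if fst u = fst s \<and> snd s = snd u + 1 then 1 else 0)) * X u)
    = X s - (if snd s = 0 then 0 else X (fst s, snd s - 1))"
proof -
  have "(\<Sum>u\<in>tree_states n. ((if u = s then 1 else 0) - (if fst u = fst s \<and> snd s = snd u + 1 then 1 else 0)) * X u)
      = (\<Sum>u\<in>tree_states n. (if u = s then X s else 0) -
          (if u = (fst s, snd s - 1) then (if snd s = 0 then 0 else X (fst s, snd s - 1)) else 0))"
    by (cases s, rule sum.cong) auto
  also have "\<dots> = X s - (if snd s = 0 then 0 else X (fst s, snd s - 1))"
  proof -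
    have "(fst s, snd s - 1) \<in> tree_states n" using assms by (auto simp: tree_states_def)
    then show ?thesis using assms finite_tree_states[OF n3]
      by (simp add: sum_subtractf)
  qed
  finally show ?thesis .
qed

text \<open>
  \<open>D\<close> below is the change of basis to the differences \<open>\<delta>(i, a) - \<delta>(i, a - 1)\<close>, and \<open>C\<close> is its inverse.
\<close>

lemma det_state_lap_rank_one:
  fixes p m :: "nat \<Rightarrow> 'r::idom"
  shows "det_on (tree_states n) (\<lambda>s t. state_lap n p m s t + (if t = (1, 0) then 1 else 0))
    = (\<Prod>w\<in>{1..n}. det_on ({1..n} - {w}) (ring_lap n p m)) *
      det_on {1..n} (\<lambda>i j. ring_lap n p m i j + (if j = 1 then 1 else 0))"
proof -
  let ?S = "tree_states n"
  define N where "N s t = state_lap n p m s t + (if t = (1, 0) then 1 else 0)" for s t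
  define D where "D s u = (if u = s then 1 else 0) - (if fst u = fst s \<and> snd s = snd u + 1 then 1 else 0 :: 'r)"
    for s u :: "nat \<times> nat"
  define C where "C s t = (if fst s = fst t \<and> snd t \<le> snd s then 1 else 0 :: 'r)"
    for s t :: "nat \<times> nat"
  \<comment> \<open>\<open>T = N C\<close> and \<open>K = D T\<close>, so \<open>K\<close> is
    \<open>N\<close> conjugated by \<open>D\<close>. The entry \<open>T s t\<close> collects row
    \<open>s\<close> of \<open>N\<close> over the states in the fibre of \<open>t\<close> from
    \<open>snd t\<close> upwards.\<close>
  define T where "T s t = (if fst s = fst t \<and> snd t \<le> snd s then p (fst s) + m (fst s) else 0)
      - (if ring_succ n (fst s) = fst t \<and> snd t \<le> min (snd s + 1) (n - 1) then p (fst s) else 0)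
      - (if ring_pred n (fst s) = fst t \<and> snd t \<le> snd s - 1 then m (fst s) else 0)
      + (if t = (1, 0) then 1 else 0)" for s t
  define K where "K s t = T s t - (if snd s = 0 then 0 else T (fst s, snd s - 1) t)" for s t
  have Dsum: "(\<Sum>u\<in>?S. D s u * X u) = X s - (if snd s = 0 then 0 else X (fst s, snd s - 1))"
    if "s \<in> ?S" for s X
    unfolding D_def by (rule sum_difference_row[OF that])
  have "det_on ?S D * det_on ?S C = det_on ?S (\<lambda>s t. \<Sum>u\<in>?S. D s u * C u t)"
    by (simp add: det_on_mult n3 finite_tree_states)
  also have "\<dots> = det_on ?S (\<lambda>s t. if s = t then 1 else 0)"
    by (rule det_on_cong) (auto simp: Dsum C_def prod_eq_iff)
  also have "\<dots> = 1" using n3 by (intro det_on_one finite_tree_states)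
  finally have DC: "det_on ?S D * det_on ?S C = 1" .
  have NC: "(\<Sum>u\<in>?S. N s u * C u t) = T s t" if s: "s \<in> ?S" and t: "t \<in> ?S" for s t
  proof -
    have "(\<Sum>u\<in>?S. N s u * C u t)
        = (\<Sum>u\<in>?S. (if u = s then (p (fst s) + m (fst s)) * C s t else 0)
          - (if u = state_up n s then p (fst s) * C (state_up n s) t else 0)
          - (if u = state_down n s then m (fst s) * C (state_down n s) t else 0)
          + (if u = (1, 0) then C (1, 0) t else 0))"
      by (rule sum.cong) (auto simp: N_def state_lap_def algebra_simps)
    also have "\<dots> = (p (fst s) + m (fst s)) * C s t - p (fst s) * C (state_up n s) t
        - m (fst s) * C (state_down n s) t + C (1, 0) t"
    proof -
      have "(1, 0) \<in> ?S" using n3 by (simp add: tree_states_def)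
      then show ?thesis
        using s state_up_in[OF n3 s] state_down_in[OF n3 s] finite_tree_states[OF n3]
        by (simp add: sum_subtractf sum.distrib)
    qed
    also have "\<dots> = T s t"
    proof -
      \<comment> \<open>\<open>(1, 0)\<close> is the lowest state of its fibre, so the perturbation
        still occupies a single column after multiplication by \<open>C\<close>; this is why it is
        placed at \<open>a = 0\<close>.\<close>
      have "C (1, 0) t = (if t = (1, 0) then 1 else 0)"
        by (cases t) (auto simp: C_def)
      moreover have "x * C s t = (if fst s = fst t \<and> snd t \<le> snd s then x else 0)"
        "x * C (state_up n s) t
          = (if ring_succ n (fst s) = fst t \<and> snd t \<le> min (snd s + 1) (n - 1) then x else 0)"
        "x * C (state_down n s) t
          = (if ring_pred n (fst s) = fst t \<and> snd t \<le> snd s - 1 then x else 0)" for x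
        by (simp_all only: C_def state_up_def state_down_def fst_conv snd_conv
            mult_1_right mult_zero_right if_distrib[of "(*) x"])
      ultimately show ?thesis by (simp only: T_def)
    qed
    finally show ?thesis .
  qed
  have "det_on ?S N = (det_on ?S D * det_on ?S C) * det_on ?S N" by (simp add: DC)
  also have "\<dots> = det_on ?S D * (det_on ?S N * det_on ?S C)" by (simp add: mult_ac)
  also have "\<dots> = det_on ?S D * det_on ?S T"
  proof -
    have "det_on ?S N * det_on ?S C = det_on ?S (\<lambda>s t. \<Sum>u\<in>?S. N s u * C u t)"
      using n3 by (simp add: det_on_mult finite_tree_states)
    also have "\<dots> = det_on ?S T" by (rule det_on_cong) (auto simp: NC)
    finally show ?thesis by simp
  qed
  also have "\<dots> = det_on ?S (\<lambda>s t. \<Sum>u\<in>?S. D s u * T u t)"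
    using n3 by (simp add: det_on_mult finite_tree_states)
  also have "\<dots> = det_on ?S K"
    by (rule det_on_cong) (auto simp: Dsum K_def)
  finally have NK: "det_on ?S N = det_on ?S K" .

  \<comment> \<open>\<open>A w\<close> is the class of states with \<open>i - a = w\<close> modulo
    \<open>n\<close> and \<open>a\<close> positive, one for each killed walk; \<open>B\<close> holds
    the lowest state of each fibre and represents the quotient.\<close>
  define A where "A w = (\<lambda>a. (ring_vertex n (int w + int a), a)) ` {1..n-1}" for w
  define B where "B = (\<lambda>i. (i, 0 :: nat)) ` {1..n}"
  have K_A: "K (i, a) (j, d) = (if i = j \<and> a = d then p i + m i else 0)
      - (if ring_succ n i = j \<and> d = a + 1 then p i else 0)
      - (if ring_pred n i = j \<and> a = d + 1 then m i else 0)"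
    if "1 \<le> a" "1 \<le> d" "a < n" "d < n" for i a j d
  proof -
    \<comment> \<open>The perturbation is the same in every row, so its contribution
      \<open>e\<close> cancels in the difference.\<close>
    have arith: "(x - y - z + e) - (x' - y' - z' + e) = (x - x') - (y - y') - (z - z')"
      for x y z x' y' z' e :: 'r by simp
    have "(if i = j \<and> d \<le> a then x else 0) - (if i = j \<and> d \<le> a - 1 then x else 0)
        = (if i = j \<and> a = d then x else 0)" for x :: 'r
      using that by auto
    \<comment> \<open>At \<open>a = n - 1\<close> the two terms of the difference agree, and
      \<open>d = a + 1\<close> is out of range: the copies have merged. The next identity does the
      same at \<open>a = 1\<close>.\<close>
    moreover have "(if k = j \<and> d \<le> min (a + 1) (n - 1) then x else 0)
          - (if k = j \<and> d \<le> min (a - 1 + 1) (n - 1) then x else 0)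
        = (if k = j \<and> d = a + 1 then x else 0)" for x :: 'r and k
      using that by auto
    moreover have "(if k = j \<and> d \<le> a - 1 then x else 0) - (if k = j \<and> d \<le> a - 1 - 1 then x else 0)
        = (if k = j \<and> a = d + 1 then x else 0)" for x :: 'r and k
      using that by auto
    moreover have "a \<noteq> 0" using that by auto
    ultimately show ?thesis
      by (simp only: K_def T_def fst_conv snd_conv if_False arith)
  qed
  \<comment> \<open>Column \<open>(j, 0)\<close> of \<open>C\<close> sums over a whole fibre, and
    the lumped rates do not depend on \<open>a\<close>. This makes \<open>K\<close> block
    triangular.\<close>
  have K_A0: "K (i, a) (j, 0) = 0" if "1 \<le> a" for i a j
    using that by (auto simp: K_def T_def)
  have K_B: "K (i, 0) (j, 0) = ring_lap n p m i j + (if j = 1 then 1 else 0)" for i j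
    by (auto simp: K_def T_def ring_lap_def)
  have A_mem: "(i, a) \<in> A w \<longleftrightarrow> 1 \<le> a \<and> a < n \<and> i = ring_vertex n (int w + int a)" for i a w
    using n3 by (auto simp: A_def)
  have A_w: "w = ring_vertex n (int i - int a)" if "(i, a) \<in> A w" "w \<in> {1..n}" for i a w
  proof -
    have "ring_vertex n (int i + - int a) = ring_vertex n (int w + int a + - int a)"
      using that ring_vertex_int_cong[OF n3, of "int w + int a" "- int a"] by (simp add: A_mem)
    then show ?thesis using ring_vertex_of_nat[OF n3 that(2)] by simp
  qed
  have S_eq: "?S = (\<Union>w\<in>{1..n}. A w) \<union> B"
  proof (intro equalityI subsetI)
    fix s assume s: "s \<in> ?S"
    obtain i a where ia: "s = (i, a)" by (cases s)
    show "s \<in> (\<Union>w\<in>{1..n}. A w) \<union> B"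
    proof (cases "a = 0")
      case True
      then show ?thesis using s by (auto simp: ia tree_states_def B_def)
    next
      case False
      let ?w = "ring_vertex n (int i - int a)"
      have "ring_vertex n (int ?w + int a) = i"
        using s ring_vertex_int_cong[OF n3, of "int i - int a" "int a"] ring_vertex_of_nat[OF n3, of i]
        by (simp add: ia tree_states_def)
      then have "(i, a) \<in> A ?w" using False s by (auto simp: A_mem ia tree_states_def)
      then show ?thesis using ring_vertex_in[OF n3] ia by blast
    qed
  next
    fix s assume "s \<in> (\<Union>w\<in>{1..n}. A w) \<union> B"
    then show "s \<in> ?S"
      using n3 by (auto simp: A_def B_def tree_states_def ring_vertex_bounds[OF n3])
  qed
  have "det_on ?S K = det_on (\<Union>w\<in>{1..n}. A w) K * det_on B K"
    unfolding S_eq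
  proof (rule det_on_block)
    show "(\<Union>w\<in>{1..n}. A w) \<inter> B = {}" by (auto simp: A_def B_def)
    fix s t assume "s \<in> (\<Union>w\<in>{1..n}. A w)" "t \<in> B"
    then show "K s t = 0" by (auto simp: A_def B_def K_A0)
  qed (auto simp: A_def B_def)
  also have "det_on (\<Union>w\<in>{1..n}. A w) K = (\<Prod>w\<in>{1..n}. det_on (A w) K)"
  proof (rule det_on_UN_blocks)
    fix v w assume vw: "v \<in> {1..n}" "w \<in> {1..n}" "v \<noteq> w"
    show "A v \<inter> A w = {}"
    proof (rule ccontr)
      assume "A v \<inter> A w \<noteq> {}"
      then obtain i a where "(i, a) \<in> A v" "(i, a) \<in> A w" by fastforce
      then show False using A_w vw by blast
    qed
    fix s t assume st: "s \<in> A v" "t \<in> A w"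
    obtain i a where s: "s = (i, a)" by (cases s)
    obtain j d where t: "t = (j, d)" by (cases t)
    have i: "i = ring_vertex n (int v + int a)" and a: "1 \<le> a" "a < n"
      using st by (auto simp: s A_mem)
    have j: "j = ring_vertex n (int w + int d)" and d: "1 \<le> d" "d < n"
      using st by (auto simp: t A_mem)
    \<comment> \<open>The three kinds of nonzero entries in \<open>K_A\<close> all preserve
      \<open>i - a\<close>; seen at position \<open>d\<close>, such an entry would identify
      \<open>v\<close> with \<open>w\<close>.\<close>
    have "ring_vertex n (int v + x) \<noteq> ring_vertex n (int w + x)" for x
    proof
      assume "ring_vertex n (int v + x) = ring_vertex n (int w + x)"
      then have "ring_vertex n (int v) = ring_vertex n (int w)"
        by (simp add: ring_vertex_eq_iff[OF n3])
      then show False using vw ring_vertex_of_nat[OF n3] by metis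
    qed
    from this[of "int d"] show "K s t = 0"
      unfolding s t K_A[OF a(1) d(1) a(2) d(2)]
      by (auto simp: i j ring_succ_vertex[OF n3] ring_pred_vertex[OF n3] algebra_simps)
  qed (auto simp: A_def)
  also have "(\<Prod>w\<in>{1..n}. det_on (A w) K) = (\<Prod>w\<in>{1..n}. det_on ({1..n} - {w}) (ring_lap n p m))"
  proof (rule prod.cong[OF refl])
    fix w assume w: "w \<in> {1..n}"
    let ?r = "\<lambda>a. ring_vertex n (int w + int a)"
    have "det_on (A w) K = det_on {1..n-1} (\<lambda>a d. K (?r a, a) (?r d, d))"
      by (rule det_on_reindex[where f = "\<lambda>a. (?r a, a)"])
        (auto simp: A_def intro!: bij_betw_imageI inj_onI)
    also have "\<dots> = det_on {1..n-1} (tridiag (\<lambda>a. p (?r a)) (\<lambda>a. m (?r a)))"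
    proof (rule det_on_cong[OF refl])
      fix a d assume ad: "a \<in> {1..n-1}" "d \<in> {1..n-1}"
      then have "1 \<le> a" "1 \<le> d" "a < n" "d < n" by auto
      moreover have "?r a = ?r d \<and> a = d \<longleftrightarrow> a = d" by auto
      moreover have "ring_succ n (?r a) = ?r d \<and> d = a + 1 \<longleftrightarrow> d = a + 1"
        by (auto simp: ring_succ_vertex[OF n3] ac_simps)
      moreover have "ring_pred n (?r a) = ?r d \<and> a = d + 1 \<longleftrightarrow> a = d + 1"
        by (auto simp: ring_pred_vertex[OF n3])
      ultimately show "K (?r a, a) (?r d, d) = tridiag (\<lambda>a. p (?r a)) (\<lambda>a. m (?r a)) a d"
        by (simp only: K_A tridiag_def)
    qed
    also have "\<dots> = det_on ({1..n} - {w}) (ring_lap n p m)"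
      by (rule det_ring_lap_minor_tridiag[OF n3 w, symmetric])
    finally show "det_on (A w) K = det_on ({1..n} - {w}) (ring_lap n p m)" .
  qed
  also have "det_on B K = det_on {1..n} (\<lambda>i j. K (i, 0) (j, 0))"
    by (rule det_on_reindex[where f = "\<lambda>i. (i, 0)"])
      (auto simp: B_def intro!: bij_betw_imageI inj_onI)
  also have "\<dots> = det_on {1..n} (\<lambda>i j. ring_lap n p m i j + (if j = 1 then 1 else 0))"
    by (simp add: K_B)
  finally show ?thesis using NK by (simp add: N_def[abs_def])
qed

text \<open>\<open>det_on_rank_one\<close> is used for both chains. For the ring,
  \<open>root_weight\<close> is at once the null vector and the minor, so it cancels and the factor
  \<open>?X\<close> equals the total weight \<open>?W\<close>. For the trees, this \<open>?W\<close>
  then cancels against the sum of the null vector.\<close>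

lemma det_state_lap_minor:
  fixes p m :: "nat \<Rightarrow> 'r::idom"
  assumes t: "t \<in> tree_states n"
    and i: "i \<in> {1..n}" "root_weight n p m i \<noteq> 0"
    and nz: "(\<Sum>s\<in>tree_states n. state_weight n p m s) \<noteq> 0"
  shows "det_on (tree_states n - {t}) (state_lap n p m)
    = state_weight n p m t * (\<Prod>w\<in>{1..n}. det_on ({1..n} - {w}) (ring_lap n p m))"
proof -
  let ?S = "tree_states n"
  let ?W = "\<Sum>s\<in>?S. state_weight n p m s"
  let ?X = "det_on {1..n} (\<lambda>i j. ring_lap n p m i j + (if j = 1 then 1 else 0))"
  let ?P = "\<Prod>w\<in>{1..n}. det_on ({1..n} - {w}) (ring_lap n p m)"
  have "root_weight n p m i * ?X
      = (\<Sum>i\<in>{1..n}. root_weight n p m i) * det_on ({1..n} - {i}) (ring_lap n p m)"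
    using n3 by (intro det_on_rank_one i ring_lap_row_sum root_weight_null) auto
  also have "(\<Sum>i\<in>{1..n}. root_weight n p m i) = ?W"
    by (simp add: root_weight_def[OF n3] tree_states_def sum.cartesian_product)
  finally have "root_weight n p m i * ?X = root_weight n p m i * ?W"
    unfolding det_ring_lap_minor[OF n3 i(1)] by (simp only: mult.commute)
  then have X: "?X = ?W"
    using i(2) by simp
  have "(1, 0) \<in> ?S" using n3 by (simp add: tree_states_def)
  then have "state_weight n p m t *
        det_on ?S (\<lambda>s t. state_lap n p m s t + (if t = (1, 0) then 1 else 0))
      = ?W * det_on (?S - {t}) (state_lap n p m)"
    using n3 finite_tree_states[OF n3]
    by (intro det_on_rank_one t state_lap_row_sum state_weight_null) auto
  then have "?W * det_on (?S - {t}) (state_lap n p m) = ?W * (state_weight n p m t * ?P)"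
    by (simp only: det_state_lap_rank_one X mult_ac)
  then show ?thesis using nz by simp
qed

end

section \<open>Covering trees of the ring\<close>

lemma pcas_hd_last:
  "pcas u p v \<Longrightarrow> p \<noteq> [] \<Longrightarrow> fst (hd p) = u \<and> snd (last p) = v"
  by (induction u p v rule: pcas.induct) (auto split: if_splits; case_tac es; auto)+

lemma pcas_nth:
  "pcas u p v \<Longrightarrow> Suc k < length p \<Longrightarrow> fst (p ! Suc k) = snd (p ! k)"
proof (induction u p v arbitrary: k rule: pcas.induct)
  case (2 u e es v)
  then show ?case by (cases k; cases es) auto
qed simp

lemma pawalk_verts_snd: "pcas u p v \<Longrightarrow> tl (pawalk_verts u p) = map snd p"
  by (induction u p v rule: pcas.induct) (auto, case_tac es, auto)

text \<open>A vertex of maximal height on the cycle has the same predecessor and successor.\<close>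

lemma (in pair_wf_digraph) cycle_length_two_if_height:
  fixes h :: "'a \<Rightarrow> int"
  assumes inj: "inj_on h (pverts G)"
    and step: "\<And>u v. (u, v) \<in> parcs G \<Longrightarrow> \<bar>h u - h v\<bar> = 1"
    and cyc: "cycle p"
  shows "length p = 2"
proof -
  obtain u where walk: "awalk u p u" and dist: "distinct (tl (pawalk_verts u p))" and ne: "p \<noteq> []"
    using cyc by (auto simp: cycle_def)
  have cas: "pcas u p u" and arcs: "set p \<subseteq> parcs G" using walk by (auto simp: awalk_def)
  have dist': "distinct (map snd p)" using dist pawalk_verts_snd[OF cas] by simp
  let ?L = "length p"
  define v where "v k = snd (p ! k)" for k
  have L: "?L > 0" using ne by simp
  \<comment> \<open>Cyclic predecessor: the first arc starts where the last one ends, so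
    \<open>v (pr k)\<close> is the tail of arc \<open>k\<close> also for
    \<open>k = 0\<close>.\<close>
  define pr where "pr k = (if k = 0 then ?L - 1 else k - 1)" for k
  have fst_p: "fst (p ! k) = v (pr k)" if "k < ?L" for k
    using that pcas_nth[OF cas] pcas_hd_last[OF cas ne] ne
    by (cases k) (auto simp: v_def pr_def hd_conv_nth last_conv_nth)
  have arc: "(v (pr k), v k) \<in> parcs G" if "k < ?L" for k
    using that arcs fst_p[OF that] by (metis nth_mem prod.collapse subsetD v_def)
  have v_inj: "v j = v k \<longleftrightarrow> j = k" if "j < ?L" "k < ?L" for j k
    using that dist' nth_eq_iff_index_eq[OF dist', of j k] by (simp add: v_def)
  have v_in: "v k \<in> pverts G" if "k < ?L" for k
    using arc[OF that] by (rule in_arcsD2)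
  define M where "M = Max ((\<lambda>k. h (v k)) ` {..<?L})"
  have "M \<in> (\<lambda>k. h (v k)) ` {..<?L}" unfolding M_def using L by (intro Max_in) auto
  then obtain k where k: "k < ?L" "M = h (v k)" by auto
  have max: "h (v j) \<le> h (v k)" if "j < ?L" for j
    using that unfolding k(2)[symmetric] M_def by (intro Max_ge) auto
  define k' where "k' = (if Suc k = ?L then 0 else Suc k)"
  have k': "k' < ?L" "pr k' = k" using k(1) by (auto simp: k'_def pr_def)
  have prk: "pr k < ?L" using k(1) by (auto simp: pr_def)
  have "h (v (pr k)) = h (v k) - 1" using step[OF arc[OF k(1)]] max[OF prk] by auto
  moreover have "h (v k') = h (v k) - 1" using step[OF arc[OF k'(1)]] max[OF k'(1)] k'(2) by auto
  ultimately have "h (v (pr k)) = h (v k')" by simp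
  then have "v (pr k) = v k'" using inj_onD[OF inj] v_in[OF prk] v_in[OF k'(1)] by blast
  then have eq: "pr k = k'" using v_inj prk k'(1) by blast
  \<comment> \<open>A loop would have height difference 0, which excludes length 1; otherwise the
    preceding and the following index agree only for length 2.\<close>
  have "pr k \<noteq> k" using step[OF arc[OF k(1)]] by auto
  with eq k(1) show ?thesis by (auto simp: pr_def k'_def split: if_splits)
qed

lemma (in pair_wf_digraph) awalk_mk_symmetric:
  assumes "awalk u p v"
  shows "pre_digraph.awalk (with_proj (mk_symmetric (with_proj G))) u p v"
  using assms
  by (force simp: pre_digraph.awalk_def cas_with_proj_eq mk_symmetric_def)

text \<open>Shortened to a path and closed by the arc, such a walk is a cycle of the symmetrization,
  so it has length 2; what remains is a pair of antiparallel arcs.\<close>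

lemma (in pair_wf_digraph) oriented_tree_no_closed_walk:
  assumes tree: "oriented_tree G" and arc: "(j, v) \<in> parcs G"
  shows "\<not> awalk v p j"
proof
  assume "awalk v p j"
  then obtain q where q: "apath v q j" using apath_awalk_to_apath by blast
  have "awalk j ((j, v) # q) j"
    using arc q by (auto simp: awalk_Cons_iff apath_def)
  from awalk_mk_symmetric[OF this]
  have "pre_digraph.cycle (with_proj (mk_symmetric (with_proj G))) ((j, v) # q)"
    using q by (auto simp: pre_digraph.cycle_def awalk_verts_with_proj_eq apath_def)
  with tree have "length ((j, v) # q) = 2" by (auto simp: oriented_tree_def)
  then obtain e where "q = [e]" by (cases q) auto
  with q have "(v, j) \<in> parcs G" by (cases e) (auto simp: apath_def awalk_def)
  with tree arc show False by (auto simp: oriented_tree_def)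
qed

text \<open>Uniqueness of the path to the root bounds the out-degree: any arc out of
  \<open>j\<close> extends to a path from \<open>j\<close> to \<open>i\<close>, because the path
  from its head cannot return to \<open>j\<close>. An arc out of \<open>i\<close> is impossible
  since the path from its head back to \<open>i\<close> would close up.\<close>

lemma covering_tree_out_arcs:
  assumes t: "t \<in> covering_trees_at G i" and i: "i \<in> pverts G"
  shows "pverts t = pverts G" "parcs t \<subseteq> parcs G"
    "\<And>u v. (u, v) \<in> parcs t \<Longrightarrow> (v, u) \<notin> parcs t"
    "\<And>v. (i, v) \<notin> parcs t"
    "\<And>j. j \<in> pverts G \<Longrightarrow> j \<noteq> i \<Longrightarrow> \<exists>!v. (j, v) \<in> parcs t"
proof -
  have sub: "subgraph (with_proj t) (with_proj G)" and tree: "oriented_tree t"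
    and ap: "\<And>j. j \<in> pverts G \<Longrightarrow> \<exists>!p. pre_digraph.apath (with_proj t) j p i"
    using t by (auto simp: covering_trees_at_def)
  have "wf_digraph (with_proj t)" using sub by (simp add: subgraph_def)
  then interpret t: pair_wf_digraph t by (simp add: wf_digraph_wp_iff)
  show "parcs t \<subseteq> parcs G" using sub by (simp add: subgraph_def)
  have "pverts t \<subseteq> pverts G" using sub by (simp add: subgraph_def)
  moreover have "j \<in> pverts t" if "j \<in> pverts G" for j
    using ap[OF that] by (auto simp: t.apath_def t.awalk_def)
  ultimately show verts: "pverts t = pverts G" by auto
  show "(v, u) \<notin> parcs t" if "(u, v) \<in> parcs t" for u v
    using that tree by (auto simp: oriented_tree_def)
  show "(i, v) \<notin> parcs t" for v
  proof
    assume a: "(i, v) \<in> parcs t"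
    then have "v \<in> pverts G" using t.in_arcsD2 verts by auto
    then obtain p where "t.apath v p i" using ap by blast
    then show False using t.oriented_tree_no_closed_walk[OF tree a] by (auto simp: t.apath_def)
  qed
  show "\<exists>!v. (j, v) \<in> parcs t" if j: "j \<in> pverts G" "j \<noteq> i" for j
  proof -
    obtain p where p: "t.apath j p i" using ap[OF j(1)] by blast
    then obtain e q where "p = e # q" using j(2) by (cases p) (auto simp: t.apath_Nil_iff)
    then have "(j, snd e) \<in> parcs t" using p by (cases e) (auto simp: t.apath_Cons_iff)
    moreover have "v = w" if v: "(j, v) \<in> parcs t" and w: "(j, w) \<in> parcs t" for v w
    proof -
      have ext: "\<exists>q. t.apath j ((j, x) # q) i" if x: "(j, x) \<in> parcs t" for x
      proof -
        have "x \<in> pverts G" using t.in_arcsD2[OF x] verts by simp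
        then obtain q where q: "t.apath x q i" using ap by blast
        have "j \<notin> set (pawalk_verts x q)"
        proof
          assume "j \<in> set (pawalk_verts x q)"
          with t.awalk_decomp[of x q i j] q obtain r where "t.awalk x r j"
            by (auto simp: t.apath_def)
          with t.oriented_tree_no_closed_walk[OF tree x] show False by blast
        qed
        with q x have "t.apath j ((j, x) # q) i" by (auto simp: t.apath_Cons_iff)
        then show ?thesis by blast
      qed
      from ext[OF v] ext[OF w] ap[OF j(1)] show ?thesis by blast
    qed
    ultimately show ?thesis by blast
  qed
qed

lemma (in pair_wf_digraph) unique_awalk_if_functional:
  assumes func: "\<And>u v w. (u, v) \<in> parcs G \<Longrightarrow> (u, w) \<in> parcs G \<Longrightarrow> v = w"
    and root: "\<And>v. (i, v) \<notin> parcs G"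
    and "awalk j p i" "awalk j q i"
  shows "p = q"
  using assms(3,4)
proof (induction p arbitrary: j q)
  case Nil
  then show ?case using root by (cases q) (auto simp: awalk_simps)
next
  case (Cons e p)
  obtain u v where e: "e = (u, v)" by (cases e)
  from Cons.prems(1) have j: "j = u" and uv: "(u, v) \<in> parcs G" and p: "awalk v p i"
    by (auto simp: awalk_Cons_iff e)
  obtain f q' where q: "q = f # q'"
    using Cons.prems(2) root uv j by (cases q) (auto simp: awalk_Nil_iff)
  obtain x y where f: "f = (x, y)" by (cases f)
  have "x = u" "(u, y) \<in> parcs G" "awalk y q' i"
    using Cons.prems(2) j by (auto simp: awalk_Cons_iff q f)
  moreover from this have "y = v" using func uv by blast
  ultimately show ?case using Cons.IH[OF p] by (simp add: e f q)
qed

text \<open>Orientation of the ring minus the edge between \<open>x + b\<close> and \<open>x + b + 1\<close> towards \<open>x\<close>.\<close>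

definition ring_arcs :: "nat \<Rightarrow> int \<Rightarrow> nat \<Rightarrow> (nat \<times> nat) set" where
  "ring_arcs n x b = (\<lambda>c. (ring_vertex n (x + int c),
     ring_vertex n (x + int c + (if c \<le> b then -1 else 1)))) ` {1..n-1}"

text \<open>\<open>ring_arcs\<close> takes the number of backward arcs, which occupy the positions
  next after the root; hence the complement \<open>n - 1 - a\<close>.\<close>

definition state_tree :: "nat \<Rightarrow> nat \<times> nat \<Rightarrow> nat pair_pre_digraph" where
  "state_tree n s = \<lparr>pverts = {1..n}, parcs = ring_arcs n (int (fst s)) (n - 1 - snd s)\<rparr>"

section \<open>Effect of a lifted step on arc sets, and injectivity of the encoding\<close>

context
  fixes n :: nat
  assumes n3: "n \<ge> 3"
begin

lemma ring_arcs_cong: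
  assumes "int n dvd x - y"
  shows "ring_arcs n x b = ring_arcs n y b"
proof -
  have "ring_vertex n (x + z) = ring_vertex n (y + z)" for z
    using assms by (simp add: ring_vertex_eq_iff[OF n3])
  from this[of "int c" for c] this[of "int c + (if c \<le> b then -1 else 1)" for c]
  show ?thesis unfolding ring_arcs_def by (simp only: add.assoc)
qed

lemma ring_arcs_vertex: "ring_arcs n (int (ring_vertex n x)) b = ring_arcs n x b"
  using ring_vertex_int_cong[OF n3, of x 0] 
  by (intro ring_arcs_cong) (simp add: ring_vertex_eq_iff[OF n3])

lemma ring_arcs_mem:
  "(u, v) \<in> ring_arcs n x b \<longleftrightarrow> (\<exists>c. 1 \<le> c \<and> c < n \<and> u = ring_vertex n (x + int c) \<and>
     v = ring_vertex n (x + int c + (if c \<le> b then -1 else 1)))"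
proof -
  have "c \<in> {1..n-1} \<longleftrightarrow> 1 \<le> c \<and> c < n" for c using n3 by auto
  then show ?thesis unfolding ring_arcs_def image_iff Bex_def prod.inject by (simp only: conj_assoc)
qed

lemma ring_vertex_exhaust:
  assumes "i \<in> {1..n}" "v \<in> {1..n}" "v \<noteq> i"
  obtains c where "1 \<le> c" "c < n" "v = ring_vertex n (int i + int c)"
proof -
  have "v \<in> (\<lambda>a. ring_vertex n (int i + int a)) ` {1..n-1}"
    using assms bij_betw_ring_vertex[OF n3 assms(1)] by (simp only: bij_betw_def Diff_iff singleton_iff) simp
  then obtain c where "c \<in> {1..n-1}" "v = ring_vertex n (int i + int c)" by blast
  then show thesis using that[of c] n3 by auto
qed

text \<open>Seen from the new root \<open>x + 1\<close> every position drops by one: position 1 is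
  the removed arc, and the new arc out of \<open>x\<close> takes position \<open>n - 1\<close>,
  where it points forwards. For \<open>b = 0\<close> the removed arc was a forward arc itself,
  whence the truncated \<open>b - 1\<close>.\<close>

lemma ring_arcs_shift_up:
  assumes "b < n"
  shows "insert (ring_vertex n x, ring_vertex n (x + 1))
      {e \<in> ring_arcs n x b. fst e \<noteq> ring_vertex n (x + 1)} = ring_arcs n (x + 1) (b - 1)"
    (is "?L = ?R")
proof (rule Set.set_eqI)
  fix e :: "nat \<times> nat"
  obtain u v where e: "e = (u, v)" by (cases e)
  have ne: "ring_vertex n (x + int c) \<noteq> ring_vertex n (x + 1)" if "c \<noteq> 1" "1 \<le> c" "c < n" for c
    using that by (subst ring_vertex_eq_small[OF n3]) auto
  have last: "ring_vertex n (x + 1 + int (n - 1)) = ring_vertex n x"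
    "ring_vertex n (x + 1 + int (n - 1) + 1) = ring_vertex n (x + 1)"
    using n3 by (simp_all add: ring_vertex_eq_iff[OF n3] of_nat_diff)
  show "e \<in> ?L \<longleftrightarrow> e \<in> ?R"
  proof
    assume "e \<in> ?L"
    then consider "u = ring_vertex n x" "v = ring_vertex n (x + 1)"
      | "(u, v) \<in> ring_arcs n x b" "u \<noteq> ring_vertex n (x + 1)" by (auto simp: e)
    then show "e \<in> ?R"
    proof cases
      case 1
      then show ?thesis unfolding e ring_arcs_mem
        by (intro exI[of _ "n - 1"]) (use n3 assms last in auto)
    next
      case 2
      then obtain c where c: "1 \<le> c" "c < n" "u = ring_vertex n (x + int c)"
        "v = ring_vertex n (x + int c + (if c \<le> b then -1 else 1))"
        by (auto simp: ring_arcs_mem)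
      with 2 have "c \<noteq> 1" by auto
      with c show ?thesis unfolding e ring_arcs_mem
        by (intro exI[of _ "c - 1"]) (auto simp: of_nat_diff)
    qed
  next
    assume "e \<in> ?R"
    then obtain c where c: "1 \<le> c" "c < n" "u = ring_vertex n (x + 1 + int c)"
        "v = ring_vertex n (x + 1 + int c + (if c \<le> b - 1 then -1 else 1))"
      by (auto simp: ring_arcs_mem e)
    show "e \<in> ?L"
    proof (cases "c = n - 1")
      case True
      then have "\<not> c \<le> b - 1" using assms n3 by auto
      then show ?thesis using c last True by (simp add: e)
    next
      case False
      have "(u, v) \<in> ring_arcs n x b" unfolding ring_arcs_mem
        by (intro exI[of _ "c + 1"]) (use c False in \<open>auto simp: algebra_simps\<close>)
      moreover have "u \<noteq> ring_vertex n (x + 1)"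
        using ne[of "c + 1"] c False by (simp add: algebra_simps)
      ultimately show ?thesis by (simp add: e)
    qed
  qed
qed

text \<open>Mirror image: positions rise by one, the new arc takes position 1 and points backwards,
  and position \<open>n - 1\<close> is dropped. If \<open>b = n - 1\<close>, the dropped arc was a
  backward arc too, whence the \<open>min\<close>.\<close>

lemma ring_arcs_shift_down:
  assumes "b < n"
  shows "insert (ring_vertex n x, ring_vertex n (x - 1))
      {e \<in> ring_arcs n x b. fst e \<noteq> ring_vertex n (x - 1)} = ring_arcs n (x - 1) (min (b + 1) (n - 1))"
    (is "?L = ?R")
proof (rule Set.set_eqI)
  fix e :: "nat \<times> nat"
  obtain u v where e: "e = (u, v)" by (cases e)
  have ne: "ring_vertex n (x + int c) \<noteq> ring_vertex n (x - 1)" if "c < n - 1" for c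
    using that by (subst ring_vertex_eq_small[OF n3]) auto
  have last: "ring_vertex n (x + int (n - 1)) = ring_vertex n (x - 1)"
    using n3 by (simp_all add: ring_vertex_eq_iff[OF n3] of_nat_diff)
  show "e \<in> ?L \<longleftrightarrow> e \<in> ?R"
  proof
    assume "e \<in> ?L"
    then consider "u = ring_vertex n x" "v = ring_vertex n (x - 1)"
      | "(u, v) \<in> ring_arcs n x b" "u \<noteq> ring_vertex n (x - 1)" by (auto simp: e)
    then show "e \<in> ?R"
    proof cases
      case 1
      then show ?thesis unfolding e ring_arcs_mem
        by (intro exI[of _ 1]) (use n3 in auto)
    next
      case 2
      then obtain c where c: "1 \<le> c" "c < n" "u = ring_vertex n (x + int c)"
        "v = ring_vertex n (x + int c + (if c \<le> b then -1 else 1))"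
        by (auto simp: ring_arcs_mem)
      with 2 last have "c \<noteq> n - 1" by auto
      with c show ?thesis unfolding e ring_arcs_mem
        by (intro exI[of _ "c + 1"]) auto
    qed
  next
    assume "e \<in> ?R"
    then obtain c where c: "1 \<le> c" "c < n" "u = ring_vertex n (x - 1 + int c)"
        "v = ring_vertex n (x - 1 + int c + (if c \<le> min (b + 1) (n - 1) then -1 else 1))"
      by (auto simp: ring_arcs_mem e)
    show "e \<in> ?L"
    proof (cases "c = 1")
      case True
      have "c \<le> min (b + 1) (n - 1)" using True n3 by auto
      then have "v = ring_vertex n (x - 1 + int c + - 1)" using c(4) by (simp only: if_True)
      then show ?thesis using c(3) True by (simp add: e)
    next
      case False
      have "(u, v) \<in> ring_arcs n x b" unfolding ring_arcs_mem
        by (intro exI[of _ "c - 1"]) (use c False in \<open>auto simp: of_nat_diff algebra_simps\<close>)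
      moreover have "u \<noteq> ring_vertex n (x - 1)"
        using ne[of "c - 1"] c False by (simp add: of_nat_diff algebra_simps)
      ultimately show ?thesis by (simp add: e)
    qed
  qed
qed

lemma lift_state_tree_up:
  assumes "s \<in> tree_states n"
  shows "lift_tree (state_tree n s) (fst s) (ring_succ n (fst s)) = state_tree n (state_up n s)"
proof -
  obtain i a where s: "s = (i, a)" by (cases s)
  have i: "i \<in> {1..n}" and a: "a < n" using assms by (auto simp: s tree_states_def)
  have "n - 1 - min (a + 1) (n - 1) = n - 1 - a - 1" by auto
  then show ?thesis
    using ring_arcs_shift_up[of "n - 1 - a" "int i"] n3
    by (simp add: lift_tree_def state_tree_def state_up_def s ring_succ_conv[OF n3 i]
        ring_arcs_vertex ring_vertex_of_nat[OF n3 i])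
qed

lemma lift_state_tree_down:
  assumes "s \<in> tree_states n"
  shows "lift_tree (state_tree n s) (fst s) (ring_pred n (fst s)) = state_tree n (state_down n s)"
proof -
  obtain i a where s: "s = (i, a)" by (cases s)
  have i: "i \<in> {1..n}" and a: "a < n" using assms by (auto simp: s tree_states_def)
  have "n - 1 - (a - 1) = min (n - 1 - a + 1) (n - 1)" using a n3 by auto
  then show ?thesis
    using ring_arcs_shift_down[of "n - 1 - a" "int i"] n3
    by (simp add: lift_tree_def state_tree_def state_down_def s ring_pred_conv[OF n3 i]
        ring_arcs_vertex ring_vertex_of_nat[OF n3 i])
qed

lemma ring_arcs_functional:
  assumes "(u, v) \<in> ring_arcs n x b" "(u, w) \<in> ring_arcs n x b"
  shows "v = w"
proof -
  obtain c where c: "1 \<le> c" "c < n" "u = ring_vertex n (x + int c)"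
    "v = ring_vertex n (x + int c + (if c \<le> b then -1 else 1))"
    using assms(1) by (auto simp: ring_arcs_mem)
  obtain d where d: "1 \<le> d" "d < n" "u = ring_vertex n (x + int d)"
    "w = ring_vertex n (x + int d + (if d \<le> b then -1 else 1))"
    using assms(2) by (auto simp: ring_arcs_mem)
  have "x + int c = x + int d"
    using c d ring_vertex_eq_small[OF n3, of "x + int c" "x + int d"] by auto
  with c d show ?thesis by simp
qed

lemma ring_arcs_root: "(ring_vertex n x, v) \<notin> ring_arcs n x b"
proof
  assume "(ring_vertex n x, v) \<in> ring_arcs n x b"
  then obtain c where "1 \<le> c" "c < n" "ring_vertex n x = ring_vertex n (x + int c)"
    by (auto simp: ring_arcs_mem)
  then show False using ring_vertex_eq_small[OF n3, of x "x + int c"] by auto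
qed

lemma ring_arcs_antisym:
  assumes "(u, v) \<in> ring_arcs n x b"
  shows "(v, u) \<notin> ring_arcs n x b"
proof
  assume "(v, u) \<in> ring_arcs n x b"
  then obtain d where d: "1 \<le> d" "d < n" "v = ring_vertex n (x + int d)"
    "u = ring_vertex n (x + int d + (if d \<le> b then -1 else 1))"
    by (auto simp: ring_arcs_mem)
  obtain c where c: "1 \<le> c" "c < n" "u = ring_vertex n (x + int c)"
    "v = ring_vertex n (x + int c + (if c \<le> b then -1 else 1))"
    using assms(1) by (auto simp: ring_arcs_mem)
  have "x + int c = x + int d + (if d \<le> b then -1 else 1)"
    using c d by (subst ring_vertex_eq_small[OF n3, symmetric]) auto
  moreover have "x + int d = x + int c + (if c \<le> b then -1 else 1)"
    using c d by (subst ring_vertex_eq_small[OF n3, symmetric]) auto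
  ultimately show False by (auto split: if_splits)
qed

text \<open>The root is the only vertex without an outgoing arc, and different thresholds disagree
  on the arc at the larger one; since \<open>n \<ge> 3\<close>, the two neighbours there are
  different vertices.\<close>

lemma state_tree_inj: "inj_on (state_tree n) (tree_states n)"
proof (rule inj_onI)
  fix s t assume s: "s \<in> tree_states n" and t: "t \<in> tree_states n" and eq: "state_tree n s = state_tree n t"
  obtain i a where ia: "s = (i, a)" by (cases s)
  obtain j d where jd: "t = (j, d)" by (cases t)
  have i: "i \<in> {1..n}" and a: "a < n" using s by (auto simp: ia tree_states_def)
  have j: "j \<in> {1..n}" and d: "d < n" using t by (auto simp: jd tree_states_def)
  have arcs: "ring_arcs n (int i) (n - 1 - a) = ring_arcs n (int j) (n - 1 - d)"
    using eq by (simp add: state_tree_def ia jd)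
  have "i = j"
  proof (rule ccontr)
    assume "i \<noteq> j"
    then obtain c where "1 \<le> c" "c < n" "j = ring_vertex n (int i + int c)"
      using ring_vertex_exhaust[OF i j] by metis
    then have "\<exists>v. (j, v) \<in> ring_arcs n (int i) (n - 1 - a)" by (auto simp: ring_arcs_mem)
    then show False using arcs ring_arcs_root[of "int j"] ring_vertex_of_nat[OF n3 j] by auto
  qed
  have aux: "\<not> b < b'" if eq': "ring_arcs n x b = ring_arcs n x b'" and b': "b' < n" for x b b'
  proof
    assume lt: "b < b'"
    let ?u = "ring_vertex n (x + int b')"
    have "(?u, ring_vertex n (x + int b' - 1)) \<in> ring_arcs n x b'"
      unfolding ring_arcs_mem using lt b' by (intro exI[of _ b']) auto
    moreover have "(?u, ring_vertex n (x + int b' + 1)) \<in> ring_arcs n x b"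
      unfolding ring_arcs_mem using lt b' by (intro exI[of _ b']) auto
    ultimately have "ring_vertex n (x + int b' - 1) = ring_vertex n (x + int b' + 1)"
      using eq' ring_arcs_functional by metis
    then show False using n3 by (simp add: ring_vertex_eq_small[OF n3])
  qed
  have "n - 1 - a < n" "n - 1 - d < n" using n3 by auto
  then have "n - 1 - a = n - 1 - d"
    using aux[of "int i" "n - 1 - a" "n - 1 - d"] aux[of "int i" "n - 1 - d" "n - 1 - a"] arcs \<open>i = j\<close>
    by auto
  then show "s = t" using a d \<open>i = j\<close> by (auto simp: ia jd)
qed

end

text \<open>Applied to the positions whose arc points backwards; \<open>b = 0\<close> means that
  there are none.\<close>

lemma downward_closed_threshold:
  assumes "n \<ge> 1" "\<And>c. 1 \<le> c \<Longrightarrow> Suc c < n \<Longrightarrow> P (Suc c) \<Longrightarrow> P c"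
  shows "\<exists>b<n. \<forall>c. 1 \<le> c \<longrightarrow> c < n \<longrightarrow> P c = (c \<le> b)"
  using assms
proof (induction n rule: nat_induct_at_least)
  case base
  then show ?case by (intro exI[of _ 0]) auto
next
  case (Suc n)
  then obtain b where b: "b < n" "\<And>c. 1 \<le> c \<Longrightarrow> c < n \<Longrightarrow> P c = (c \<le> b)"
    by (metis less_SucI)
  show ?case
  proof (cases "P n")
    case True
    have "b = n - 1"
    proof (cases "n = 1")
      case False
      then have "P (n - 1)" using Suc.prems[of "n - 1"] Suc.hyps True by auto
      then show ?thesis using b False Suc.hyps by auto
    qed (use b in auto)
    then show ?thesis using True b Suc.hyps
      by (intro exI[of _ n]) (auto simp: less_Suc_eq)
  next
    case False
    then show ?thesis using b by (intro exI[of _ b]) (auto simp: less_Suc_eq)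
  qed
qed

section \<open>Classification of the covering trees; weights and lifted matrix in state
  coordinates\<close>

context
  fixes n :: nat
  assumes n3: "n \<ge> 3"
begin

lemma pverts_ring_graph [simp]: "pverts (ring_graph n) = {1..n}"
  by (simp add: ring_graph_def)

lemma ring_graph_arc_iff:
  "(i, j) \<in> parcs (ring_graph n) \<longleftrightarrow> i \<in> {1..n} \<and> (j = ring_succ n i \<or> j = ring_pred n i)"
  by (simp add: ring_graph_def)

lemma ring_succ_neq_pred: "i \<in> {1..n} \<Longrightarrow> ring_succ n i \<noteq> ring_pred n i"
  using ring_vertex_eq_small[OF n3, of "int i + 1" "int i - 1"] n3
  by (simp only: ring_succ_conv[OF n3] ring_pred_conv[OF n3])

lemma ring_succ_neq: "i \<in> {1..n} \<Longrightarrow> ring_succ n i \<noteq> i"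
  using n3 by (auto simp: ring_succ_def)

lemma ring_pred_neq: "i \<in> {1..n} \<Longrightarrow> ring_pred n i \<noteq> i"
  using n3 by (auto simp: ring_pred_def)

lemma ring_arcs_subset: "ring_arcs n x b \<subseteq> parcs (ring_graph n)"
proof (intro subrelI)
  fix u v assume "(u, v) \<in> ring_arcs n x b"
  then obtain c where "u = ring_vertex n (x + int c)"
    "v = ring_vertex n (x + int c + (if c \<le> b then -1 else 1))"
    by (auto simp: ring_arcs_mem[OF n3])
  then show "(u, v) \<in> parcs (ring_graph n)"
    using ring_vertex_in[OF n3]
    by (simp add: ring_graph_arc_iff ring_succ_vertex[OF n3] ring_pred_vertex[OF n3] del: atLeastAtMost_iff)
qed

text \<open>An arc from position \<open>c + 1\<close> back to \<open>c\<close> forbids the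
  antiparallel arc, so position \<open>c\<close> points backwards too. The backward positions thus
  form an initial segment, whose length determines the tree.\<close>

lemma covering_tree_is_state_tree:
  assumes i: "i \<in> {1..n}" and t: "t \<in> covering_trees_at (ring_graph n) i"
  shows "\<exists>a<n. t = state_tree n (i, a)"
proof -
  have iG: "i \<in> pverts (ring_graph n)" using i by simp
  note tr = covering_tree_out_arcs[OF t iG, unfolded pverts_ring_graph]
  let ?r = "\<lambda>c. ring_vertex n (int i + int c)"
  define P where "P c \<longleftrightarrow> (?r c, ring_vertex n (int i + int c - 1)) \<in> parcs t" for c
  have ex1: "\<exists>!v. (?r c, v) \<in> parcs t" if "1 \<le> c" "c < n" for c
  proof (rule tr(5))
    show "?r c \<in> {1..n}" by (rule ring_vertex_in[OF n3])
    show "?r c \<noteq> i"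
      using that ring_vertex_eq_small[OF n3, of "int i + int c" "int i"] ring_vertex_of_nat[OF n3 i] by simp
  qed
  have nb: "v = ring_vertex n (int i + int c + 1) \<or> v = ring_vertex n (int i + int c - 1)"
    if "(?r c, v) \<in> parcs t" for c v
    using that tr(2) by (auto simp: ring_graph_arc_iff ring_succ_vertex[OF n3] ring_pred_vertex[OF n3])
  have plus: "(?r c, ring_vertex n (int i + int c + 1)) \<in> parcs t" if "1 \<le> c" "c < n" "\<not> P c" for c
    using ex1[OF that(1,2)] nb[of c] that(3) unfolding P_def by metis
  have down: "P c" if c: "1 \<le> c" "Suc c < n" "P (Suc c)" for c
  proof (rule ccontr)
    assume "\<not> P c"
    then have "(?r c, ring_vertex n (int i + int c + 1)) \<in> parcs t" using plus c by simp
    moreover have "(ring_vertex n (int i + int c + 1), ?r c) \<in> parcs t"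
      using c(3) by (simp add: P_def algebra_simps)
    ultimately show False using tr(3) by blast
  qed
  obtain b where b: "b < n" "\<And>c. 1 \<le> c \<Longrightarrow> c < n \<Longrightarrow> P c = (c \<le> b)"
    using downward_closed_threshold[of n P] down n3 by auto
  have arc: "(?r c, ring_vertex n (int i + int c + (if c \<le> b then -1 else 1))) \<in> parcs t"
    if "1 \<le> c" "c < n" for c
    using b(2)[OF that] plus[OF that] by (auto simp: P_def)
  have "parcs t = ring_arcs n (int i) b"
  proof (intro equalityI subrelI)
    fix u v assume uv: "(u, v) \<in> parcs t"
    have "u \<noteq> i" using uv tr(4) by blast
    moreover have "u \<in> {1..n}" using uv tr(2) ring_graph_arc_iff by blast
    ultimately obtain c where c: "1 \<le> c" "c < n" "u = ?r c"
      using ring_vertex_exhaust[OF n3 i] by metis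
    then have "v = ring_vertex n (int i + int c + (if c \<le> b then -1 else 1))"
      using arc[OF c(1,2)] ex1[OF c(1,2)] uv by blast
    then show "(u, v) \<in> ring_arcs n (int i) b" using c unfolding ring_arcs_mem[OF n3] by blast
  next
    fix u v assume "(u, v) \<in> ring_arcs n (int i) b"
    then show "(u, v) \<in> parcs t" using arc unfolding ring_arcs_mem[OF n3] by blast
  qed
  then have "t = state_tree n (i, n - 1 - b)"
    using tr(1) b(1) by (cases t) (simp add: state_tree_def)
  then show ?thesis using n3 by (intro exI[of _ "n - 1 - b"]) auto
qed

text \<open>Outgoing arcs are unique and lead to the root, so paths to the root are unique. The
  absence of undirected cycles comes from unrolling the ring at the missing edge.\<close>

lemma state_tree_is_covering_tree:
  assumes i: "i \<in> {1..n}" and a: "a < n"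
  shows "state_tree n (i, a) \<in> covering_trees_at (ring_graph n) i"
proof -
  define b where "b = n - 1 - a"
  have b: "b < n" using n3 by (simp add: b_def)
  let ?r = "\<lambda>c. ring_vertex n (int i + int c)"
  define t where "t = state_tree n (i, a)"
  have pv: "pverts t = {1..n}" and pa: "parcs t = ring_arcs n (int i) b"
    by (simp_all add: t_def state_tree_def b_def)
  have wfG: "pair_wf_digraph (ring_graph n)"
  proof (unfold_locales, unfold pverts_ring_graph)
    fix e assume "e \<in> parcs (ring_graph n)"
    then have "fst e \<in> {1..n}" "snd e = ring_succ n (fst e) \<or> snd e = ring_pred n (fst e)"
      by (cases e, simp only: ring_graph_arc_iff fst_conv snd_conv)+
    then show "fst e \<in> {1..n}" "snd e \<in> {1..n}"
      using ring_succ_in[OF n3] ring_pred_in[OF n3] by metis+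
  qed
  have arcsG: "parcs t \<subseteq> parcs (ring_graph n)" unfolding pa by (rule ring_arcs_subset)
  interpret t: pair_wf_digraph t
  proof unfold_locales
    fix e assume "e \<in> parcs t"
    then have "e \<in> parcs (ring_graph n)" using arcsG by blast
    then show "fst e \<in> pverts t" "snd e \<in> pverts t"
      using pair_wf_digraph.arc_fst_in_verts[OF wfG] pair_wf_digraph.arc_snd_in_verts[OF wfG]
      unfolding pv pverts_ring_graph by blast+
  qed
  have rin: "?r c \<in> pverts t" for c using ring_vertex_in[OF n3] pv by simp
  have r0: "?r 0 = i" "?r n = i"
    using ring_vertex_of_nat[OF n3 i] by (simp_all add: ring_vertex_add_n[OF n3])
  have minus_walk: "\<exists>p. t.awalk (?r c) p i" if "c \<le> b" for c
    using that
  proof (induction c)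
    case 0
    then show ?case using rin[of 0] r0 by (auto simp: t.awalk_Nil_iff intro!: exI[of _ "[]"])
  next
    case (Suc c)
    then obtain p where p: "t.awalk (?r c) p i" by auto
    have "(?r (Suc c), ?r c) \<in> parcs t"
      unfolding pa ring_arcs_mem[OF n3] using Suc.prems b by (intro exI[of _ "Suc c"]) auto
    with p show ?case by (intro exI[of _ "(?r (Suc c), ?r c) # p"]) (simp add: t.awalk_Cons_iff)
  qed
  \<comment> \<open>Induction backwards from position \<open>n\<close>, which is the root
    again.\<close>
  have plus_walk: "\<exists>p. t.awalk (?r (n - k)) p i" if "n - k > b" for k
    using that
  proof (induction k)
    case 0
    then show ?case using rin[of n] r0 by (auto simp: t.awalk_Nil_iff intro!: exI[of _ "[]"])
  next
    case (Suc k)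
    then have "b < n - k" by linarith
    then obtain p where p: "t.awalk (?r (n - k)) p i" using Suc.IH by blast
    have "(?r (n - Suc k), ?r (n - k)) \<in> parcs t"
      unfolding pa ring_arcs_mem[OF n3] using Suc.prems
      by (intro exI[of _ "n - Suc k"]) (auto simp: of_nat_diff algebra_simps)
    with p show ?case
      by (intro exI[of _ "(?r (n - Suc k), ?r (n - k)) # p"]) (simp add: t.awalk_Cons_iff)
  qed
  have walk: "\<exists>p. t.awalk v p i" if v: "v \<in> {1..n}" for v
  proof (cases "v = i")
    case True
    then show ?thesis using minus_walk[of 0] r0 by auto
  next
    case False
    then obtain c where c: "1 \<le> c" "c < n" "v = ?r c"
      using ring_vertex_exhaust[OF n3 i v] by metis
    then show ?thesis using minus_walk[of c] plus_walk[of "n - c"] by (cases "c \<le> b") auto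
  qed
  have func: "v = w" if "(u, v) \<in> parcs t" "(u, w) \<in> parcs t" for u v w
    using that unfolding pa by (rule ring_arcs_functional[OF n3])
  have noroot: "(i, v) \<notin> parcs t" for v
    using ring_arcs_root[OF n3, of "int i"] ring_vertex_of_nat[OF n3 i] by (simp add: pa)
  have unique: "\<exists>!p. t.apath v p i" if v: "v \<in> {1..n}" for v
  proof -
    obtain p where "t.awalk v p i" using walk[OF v] by blast
    then obtain q where q: "t.apath v q i" using t.apath_awalk_to_apath by blast
    show ?thesis
    proof (rule ex1I[of _ q])
      show "t.apath v q i" by (rule q)
      fix q' assume "t.apath v q' i"
      with q show "q' = q"
        by (intro t.unique_awalk_if_functional[OF func noroot]) (auto simp: t.apath_def)
    qed
  qed
  have anti: "(v, u) \<notin> parcs t" if "(u, v) \<in> parcs t" for u v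
    using that ring_arcs_antisym[OF n3] by (simp add: pa)
  interpret s: pair_wf_digraph "mk_symmetric (with_proj t)" by (rule t.wellformed_mk_symmetric)
  have sarcs: "(u, v) \<in> parcs (mk_symmetric (with_proj t)) \<longleftrightarrow> (u, v) \<in> parcs t \<or> (v, u) \<in> parcs t" for u v
    unfolding parcs_mk_symmetric with_proj_simps UN_iff
  proof
    assume "\<exists>e\<in>parcs t. (u, v) \<in> {(fst e, snd e), (snd e, fst e)}"
    then show "(u, v) \<in> parcs t \<or> (v, u) \<in> parcs t" by auto
  next
    assume "(u, v) \<in> parcs t \<or> (v, u) \<in> parcs t"
    then show "\<exists>e\<in>parcs t. (u, v) \<in> {(fst e, snd e), (snd e, fst e)}"
      by (elim disjE) (rule bexI[rotated], assumption, simp)+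
  qed
  let ?sym = "with_proj (mk_symmetric (with_proj t))"
  have conn: "connected (with_proj t)"
    unfolding connected_def
  proof (rule strongly_connectedI)
    show "verts ?sym \<noteq> {}" using n3 by (simp add: pv)
    fix u v assume uv: "u \<in> verts ?sym" "v \<in> verts ?sym"
    have to_root: "x \<rightarrow>\<^sup>*\<^bsub>?sym\<^esub> i" if x: "x \<in> {1..n}" for x
    proof -
      obtain p where p: "t.awalk x p i" using walk[OF x] by blast
      from t.awalk_mk_symmetric[OF p] show ?thesis by (rule s.reachable_awalkI)
    qed
    have u: "u \<rightarrow>\<^sup>*\<^bsub>?sym\<^esub> i" using uv(1) by (intro to_root) (simp add: pv)
    have "v \<rightarrow>\<^sup>*\<^bsub>?sym\<^esub> i" using uv(2) by (intro to_root) (simp add: pv)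
    then have "i \<rightarrow>\<^sup>*\<^bsub>?sym\<^esub> v" by (rule symmetric_reachable[OF symmetric_mk_symmetric])
    with u show "u \<rightarrow>\<^sup>*\<^bsub>?sym\<^esub> v" by (rule s.reachable_trans)
  qed
  \<comment> \<open>Unrolling at the missing edge between positions \<open>b\<close> and
    \<open>b + 1\<close>: raising positions \<open>0\<close> to \<open>b\<close> by \<open>n\<close>
    numbers the vertices consecutively from \<open>b + 1\<close> to \<open>b + n\<close>, so that
    every arc changes \<open>h\<close> by one.\<close>
  define h where "h v = (let c = (int v - int i) mod int n in if c \<le> int b then c + int n else c)"
    for v :: nat
  have h: "h (ring_vertex n (int i + c)) = (if c \<le> int b then c + int n else c)"
    if "0 \<le> c" "c < int n" for c
  proof -
    have "int n dvd int (ring_vertex n (int i + c)) - (int i + c)"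
      using ring_vertex_int_cong[OF n3, of "int i + c" 0] by (simp add: ring_vertex_eq_iff[OF n3])
    then have "(int (ring_vertex n (int i + c)) - int i) mod int n = c mod int n"
      by (simp add: mod_eq_dvd_iff algebra_simps)
    also have "\<dots> = c" using that by simp
    finally show ?thesis by (simp add: h_def Let_def)
  qed
  have h_arc: "\<bar>h u - h v\<bar> = 1" if "(u, v) \<in> parcs t" for u v
  proof -
    obtain c where c: "1 \<le> c" "c < n" "u = ?r c"
      "v = ring_vertex n (int i + int c + (if c \<le> b then -1 else 1))"
      using \<open>(u, v) \<in> parcs t\<close> by (auto simp: pa ring_arcs_mem[OF n3])
    have hu: "h u = (if c \<le> b then int c + int n else int c)" using h[of "int c"] c by simp
    show ?thesis
    proof (cases "c \<le> b")
      case True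
      then have "h v = int c - 1 + int n" using h[of "int c - 1"] c by (simp add: algebra_simps)
      then show ?thesis using hu True by simp
    next
      case False
      show ?thesis
      proof (cases "Suc c = n")
        case True
        \<comment> \<open>The last forward arc enters the root, whose position 0 was raised to
          height \<open>n\<close>.\<close>
        then have "int n = int c + 1" by linarith
        then have "v = ring_vertex n (int i + 0)"
          using c(4) False r0 by (simp add: add.assoc)
        then have "h v = int n" using h[of 0] n3 by simp
        then show ?thesis using hu False True by simp
      next
        case no: False
        then have "h v = int c + 1" using h[of "int c + 1"] c False by (simp add: algebra_simps)
        then show ?thesis using hu False by simp
      qed
    qed
  qed
  have h_inj: "inj_on h {1..n}"
  proof (rule inj_onI)
    fix u v assume uv: "u \<in> {1..n}" "v \<in> {1..n}" "h u = h v"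
    have "h w mod int n = (int w - int i) mod int n" for w
      by (simp add: h_def Let_def)
    then have "(int u - int i) mod int n = (int v - int i) mod int n"
      using uv(3) by metis
    then have "int n dvd int u - int v" by (simp add: mod_eq_dvd_iff)
    moreover have "\<bar>int u - int v\<bar> < int n" using uv by auto
    ultimately have "int u - int v = 0" by (rule int_multiple_small[OF n3])
    then show "u = v" by simp
  qed
  have cyc: "length p = 2" if "s.cycle p" for p
  proof (rule s.cycle_length_two_if_height[OF _ _ that])
    show "inj_on h (pverts (mk_symmetric (with_proj t)))" using h_inj by (simp add: pv)
    show "\<bar>h u - h v\<bar> = 1" if "(u, v) \<in> parcs (mk_symmetric (with_proj t))" for u v
      using that h_arc[of u v] h_arc[of v u] by (auto simp: sarcs abs_minus_commute)
  qed
  have "subgraph (with_proj t) (with_proj (ring_graph n))"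
    using wfG t.pair_wf_digraph_axioms arcsG
    by (simp add: subgraph_def wf_digraph_wp_iff pv compatibleI_with_proj)
  moreover have "oriented_tree t"
    using conn anti cyc by (auto simp: oriented_tree_def)
  ultimately show ?thesis
    using unique by (simp add: covering_trees_at_def t_def[symmetric])
qed

lemma covering_trees_at_ring:
  assumes i: "i \<in> {1..n}"
  shows "covering_trees_at (ring_graph n) i = (\<lambda>a. state_tree n (i, a)) ` {0..<n}"
proof (intro equalityI subsetI)
  fix t assume "t \<in> covering_trees_at (ring_graph n) i"
  then show "t \<in> (\<lambda>a. state_tree n (i, a)) ` {0..<n}"
    using covering_tree_is_state_tree[OF i] by fastforce
next
  fix t assume "t \<in> (\<lambda>a. state_tree n (i, a)) ` {0..<n}"
  then show "t \<in> covering_trees_at (ring_graph n) i"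
    using state_tree_is_covering_tree[OF i] by auto
qed

lemma covering_trees_ring: "covering_trees (ring_graph n) = state_tree n ` tree_states n"
  by (auto simp: covering_trees_def covering_trees_at_ring tree_states_def simp del: atLeastAtMost_iff)

lemma bij_betw_state_tree:
  "bij_betw (state_tree n) (tree_states n) (covering_trees (ring_graph n))"
  using state_tree_inj[OF n3] by (simp add: bij_betw_def covering_trees_ring)

lemma tree_root_state_tree:
  assumes s: "s \<in> tree_states n"
  shows "tree_root (ring_graph n) (state_tree n s) = fst s"
  unfolding tree_root_def pverts_ring_graph
proof (rule the_equality)
  have "fst s \<in> {1..n}" "snd s < n" using s by (auto simp: tree_states_def)
  then show "fst s \<in> {1..n} \<and> state_tree n s \<in> covering_trees_at (ring_graph n) (fst s)"
    using state_tree_is_covering_tree[of "fst s" "snd s"] by simp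
next
  fix i assume i: "i \<in> {1..n} \<and> state_tree n s \<in> covering_trees_at (ring_graph n) i"
  then obtain a where a: "a < n" "state_tree n s = state_tree n (i, a)"
    using covering_tree_is_state_tree by blast
  have "(i, a) \<in> tree_states n" using a i by (simp add: tree_states_def)
  then have "s = (i, a)" using a s state_tree_inj[OF n3] by (auto dest: inj_onD)
  then show "i = fst s" by simp
qed

lemma tree_weight_state_tree:
  assumes s: "s \<in> tree_states n"
  shows "tree_weight q (state_tree n s)
    = state_weight n (\<lambda>i. q i (ring_succ n i)) (\<lambda>i. q i (ring_pred n i)) s"
proof -
  obtain i a where ia: "s = (i, a)" by (cases s)
  have i: "i \<in> {1..n}" and a: "a < n" using s by (auto simp: ia tree_states_def)
  define b where "b = n - 1 - a"
  let ?r = "\<lambda>c. ring_vertex n (int i + int c)"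
  have b: "b < n" "a = n - 1 - b" using a n3 by (auto simp: b_def)
  have inj: "inj_on (\<lambda>c. (?r c, ring_vertex n (int i + int c + (if c \<le> b then -1 else 1)))) {1..n-1}"
    using bij_betw_ring_vertex[OF n3 i] by (auto simp: bij_betw_def inj_on_def)
  have arcs: "parcs (state_tree n s) = ring_arcs n (int i) b"
    by (simp add: state_tree_def ia b_def)
  have "tree_weight q (state_tree n s)
      = (\<Prod>c\<in>{1..n-1}. q (?r c) (ring_vertex n (int i + int c + (if c \<le> b then -1 else 1))))"
    unfolding tree_weight_def arcs ring_arcs_def prod.reindex[OF inj] by (simp only: o_def prod.case)
  also have "{1..n-1} = {1..b} \<union> {b+1..n-1}" using b by auto
  also have "(\<Prod>c\<in>{1..b} \<union> {b+1..n-1}. q (?r c) (ring_vertex n (int i + int c + (if c \<le> b then -1 else 1))))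
      = (\<Prod>c=1..b. q (?r c) (ring_vertex n (int i + int c + (if c \<le> b then -1 else 1)))) *
        (\<Prod>c=b+1..n-1. q (?r c) (ring_vertex n (int i + int c + (if c \<le> b then -1 else 1))))"
    by (rule prod.union_disjoint) auto
  also have "(\<Prod>c=1..b. q (?r c) (ring_vertex n (int i + int c + (if c \<le> b then -1 else 1))))
      = (\<Prod>c=1..b. q (?r c) (ring_pred n (?r c)))"
    by (rule prod.cong) (auto simp: ring_pred_vertex[OF n3])
  also have "(\<Prod>c=b+1..n-1. q (?r c) (ring_vertex n (int i + int c + (if c \<le> b then -1 else 1))))
      = (\<Prod>c=b+1..n-1. q (?r c) (ring_succ n (?r c)))"
    by (rule prod.cong) (auto simp: ring_succ_vertex[OF n3])
  also have "(\<Prod>c=1..b. q (?r c) (ring_pred n (?r c))) * (\<Prod>c=b+1..n-1. q (?r c) (ring_succ n (?r c)))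
      = state_weight n (\<lambda>i. q i (ring_succ n i)) (\<lambda>i. q i (ring_pred n i)) s"
    unfolding ia b(2) by (rule state_weight_product[OF n3 b(1), symmetric])
  finally show ?thesis .
qed

lemma lifted_offdiag_state_tree:
  assumes s: "s \<in> tree_states n" and t: "t \<in> tree_states n"
  shows "lifted_offdiag (ring_graph n) q (state_tree n s) (state_tree n t)
    = (if state_up n s = t then q (fst s) (ring_succ n (fst s)) else 0)
      + (if state_down n s = t then q (fst s) (ring_pred n (fst s)) else 0)"
proof -
  have i: "fst s \<in> {1..n}" using s by (auto simp: tree_states_def)
  have ud: "fst (state_up n s) = ring_succ n (fst s)" "fst (state_down n s) = ring_pred n (fst s)"
    by (simp_all add: state_up_def state_down_def)
  have up: "state_tree n t = state_tree n (state_up n s) \<longleftrightarrow> t = state_up n s"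
    using state_tree_inj[OF n3] t state_up_in[OF n3 s] by (auto dest: inj_onD)
  have down: "state_tree n t = state_tree n (state_down n s) \<longleftrightarrow> t = state_down n s"
    using state_tree_inj[OF n3] t state_down_in[OF n3 s] by (auto dest: inj_onD)
  have "lifted_offdiag (ring_graph n) q (state_tree n s) (state_tree n t)
      = (if (fst t = ring_succ n (fst s) \<or> fst t = ring_pred n (fst s)) \<and>
            state_tree n t = lift_tree (state_tree n s) (fst s) (fst t) then q (fst s) (fst t) else 0)"
    using i by (simp add: lifted_offdiag_def tree_root_state_tree s t ring_graph_arc_iff)
  also have "\<dots> = (if t = state_up n s then q (fst s) (ring_succ n (fst s))
      else if t = state_down n s then q (fst s) (ring_pred n (fst s)) else 0)"
    using up down ud lift_state_tree_up[OF n3 s] lift_state_tree_down[OF n3 s]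
    by auto
  \<comment> \<open>The two jumps have different targets because \<open>n \<ge> 3\<close>, so the
    nested conditional equals a sum.\<close>
  finally show ?thesis using ud ring_succ_neq_pred[OF i] by auto
qed

lemma lifted_matrix_state_tree:
  assumes s: "s \<in> tree_states n" and t: "t \<in> tree_states n"
  shows "- lifted_matrix (ring_graph n) q (state_tree n s) (state_tree n t)
    = state_lap n (\<lambda>i. q i (ring_succ n i)) (\<lambda>i. q i (ring_pred n i)) s t"
proof -
  have i: "fst s \<in> {1..n}" using s by (auto simp: tree_states_def)
  have ne: "state_up n s \<noteq> s" "state_down n s \<noteq> s"
    using ring_succ_neq[OF i] ring_pred_neq[OF i] by (auto simp: state_up_def state_down_def prod_eq_iff)
  have eq_iff: "state_tree n s = state_tree n t \<longleftrightarrow> s = t"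
    using state_tree_inj[OF n3] s t by (auto dest: inj_onD)
  have bij: "bij_betw (state_tree n) (tree_states n - {s}) (covering_trees (ring_graph n) - {state_tree n s})"
    using bij_betw_state_tree s by (intro bij_betw_DiffI) (auto simp: covering_trees_ring)
  have "(\<Sum>u\<in>covering_trees (ring_graph n) - {state_tree n s}. lifted_offdiag (ring_graph n) q (state_tree n s) u)
      = (\<Sum>u\<in>tree_states n - {s}. lifted_offdiag (ring_graph n) q (state_tree n s) (state_tree n u))"
    by (rule sum.reindex_bij_betw[OF bij, symmetric])
  also have "\<dots> = (\<Sum>u\<in>tree_states n - {s}. (if state_up n s = u then q (fst s) (ring_succ n (fst s)) else 0)
      + (if state_down n s = u then q (fst s) (ring_pred n (fst s)) else 0))"
    using s by (intro sum.cong refl lifted_offdiag_state_tree) auto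
  also have "\<dots> = q (fst s) (ring_succ n (fst s)) + q (fst s) (ring_pred n (fst s))"
    using ne state_up_in[OF n3 s] state_down_in[OF n3 s] finite_tree_states[OF n3]
    by (simp add: sum.distrib)
  finally show ?thesis
    using ne lifted_offdiag_state_tree[OF s t, of q]
    by (auto simp: lifted_matrix_def eq_iff state_lap_def)
qed

lemma ring_lap_eq_rates:
  assumes "i \<in> {1..n}"
  shows "ring_lap n (\<lambda>i. rate_var i (ring_succ n i)) (\<lambda>i. rate_var i (ring_pred n i)) i j
    = - ring_rates n i j"
  using assms ring_succ_neq[OF assms] ring_pred_neq[OF assms] ring_succ_neq_pred[OF assms]
  by (auto simp: ring_lap_def ring_rates_def ring_graph_arc_iff)

end

section \<open>Nonvanishing of sums of tree weights, and the theorem\<close>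

lemma tree_weight_rate_var:
  "tree_weight rate_var t
    = (Poly_Mapping.single (\<Sum>e\<in>parcs t. Poly_Mapping.single e 1) 1 :: 'a::idom rate_poly)"
proof -
  have "(\<Prod>(k, l)\<in>E. rate_var k l)
      = (Poly_Mapping.single (\<Sum>e\<in>E. Poly_Mapping.single e 1) 1 :: 'a rate_poly)" for E
    by (induction E rule: infinite_finite_induct)
      (auto simp: rate_var_def mult_single)
  then show ?thesis by (simp add: tree_weight_def)
qed

text \<open>Distinct arc sets give distinct squarefree monomials, so there is no cancellation.\<close>

lemma sum_tree_weight_nonzero:
  assumes fin: "finite U" and t: "t \<in> U"
    and inj: "inj_on parcs U" and arcs: "\<And>t. t \<in> U \<Longrightarrow> finite (parcs t)"
  shows "(\<Sum>t\<in>U. tree_weight rate_var t :: 'a::idom rate_poly) \<noteq> 0"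
proof -
  define mono :: "nat pair_pre_digraph \<Rightarrow> (nat \<times> nat) \<Rightarrow>\<^sub>0 nat"
    where "mono t = (\<Sum>e\<in>parcs t. Poly_Mapping.single e 1)" for t
  have look: "Poly_Mapping.lookup (mono u) e = (if e \<in> parcs u then 1 else 0)" if "u \<in> U" for u e
    using arcs[OF that] by (simp add: mono_def Poly_Mapping.lookup_sum lookup_single when_def)
  have mono_eq: "mono u = mono t \<longleftrightarrow> u = t" if u: "u \<in> U" for u
  proof
    assume eq: "mono u = mono t"
    have "e \<in> parcs u \<longleftrightarrow> e \<in> parcs t" for e
      using look[OF u, of e] look[OF t, of e] unfolding eq by (metis zero_neq_one)
    then have "parcs u = parcs t" by blast
    then show "u = t" using inj_onD[OF inj] u t by blast
  qed simp
  \<comment> \<open>The coefficient at the monomial of \<open>t\<close> is exactly 1, whatever the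
    characteristic of \<open>'a\<close>.\<close>
  have "Poly_Mapping.lookup (\<Sum>u\<in>U. tree_weight rate_var u :: 'a rate_poly) (mono t)
      = (\<Sum>u\<in>U. if u = t then 1 else 0)"
    unfolding Poly_Mapping.lookup_sum
  proof (rule sum.cong[OF refl])
    fix u assume "u \<in> U"
    then show "Poly_Mapping.lookup (tree_weight rate_var u :: 'a rate_poly) (mono t) = (if u = t then 1 else 0)"
      unfolding tree_weight_rate_var mono_def[symmetric] lookup_single by (simp only: mono_eq when_def)
  qed
  also have "\<dots> = 1" using fin t by simp
  finally show ?thesis by auto
qed

theorem theorem2:
  fixes n :: nat
    and Q :: "nat \<Rightarrow> nat \<Rightarrow> 'a::idom rate_poly"
    and T :: "nat pair_pre_digraph set"
    and R :: "nat pair_pre_digraph \<Rightarrow> nat pair_pre_digraph \<Rightarrow> 'a rate_poly"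
    and weight :: "nat pair_pre_digraph \<Rightarrow> 'a rate_poly"
  assumes "n \<ge> 3"
    and Q_def: "Q = ring_rates n"
    and T_def: "T = covering_trees (ring_graph n)"
    and R_def: "R = lifted_matrix (ring_graph n) rate_var"
    and weight_def: "weight = tree_weight rate_var"
  shows "(\<forall>t\<in>T. det_on (T - {t}) (\<lambda>s u. - R s u) =
            weight t * (\<Prod>i=1..n. det_on ({1..n} - {i}) (\<lambda>k l. - Q k l))) \<and>
         (\<forall>\<Psi>. (\<forall>t\<in>T. det_on (T - {t}) (\<lambda>s u. - R s u) = weight t * \<Psi>) \<longrightarrow>
            \<Psi> = (\<Prod>i=1..n. det_on ({1..n} - {i}) (\<lambda>k l. - Q k l)))"
proof -
  note n3 = \<open>n \<ge> 3\<close>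
  let ?S = "tree_states n"
  let ?p = "\<lambda>i. rate_var i (ring_succ n i) :: 'a rate_poly"
  let ?m = "\<lambda>i. rate_var i (ring_pred n i) :: 'a rate_poly"
  let ?\<Psi> = "\<Prod>i=1..n. det_on ({1..n} - {i}) (\<lambda>k l. - Q k l)"
  have T_image: "T = state_tree n ` ?S" using covering_trees_ring[OF n3] by (simp add: T_def)
  have weight_state: "weight (state_tree n s) = state_weight n ?p ?m s" if "s \<in> ?S" for s
    unfolding weight_def by (rule tree_weight_state_tree[OF n3 that])
  \<comment> \<open>Used for three sets \<open>U\<close>: the fibre of one root, all states, and a
    single state.\<close>
  have nonzero: "(\<Sum>s\<in>U. state_weight n ?p ?m s) \<noteq> 0" if U: "U \<subseteq> ?S" "s \<in> U" for U s
  proof -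
    have inj: "inj_on (state_tree n) U"
      using state_tree_inj[OF n3] U(1) by (rule inj_on_subset)
    have "(\<Sum>s\<in>U. state_weight n ?p ?m s) = (\<Sum>s\<in>U. weight (state_tree n s))"
      by (rule sum.cong[OF refl]) (rule weight_state[symmetric], use U(1) in blast)
    also have "\<dots> = (\<Sum>t\<in>state_tree n ` U. weight t)"
      by (simp only: sum.reindex[OF inj] o_def)
    also have "\<dots> \<noteq> 0"
      unfolding weight_def
    proof (rule sum_tree_weight_nonzero)
      show "finite (state_tree n ` U)"
        using finite_subset[OF U(1) finite_tree_states[OF n3]] by simp
      show "state_tree n s \<in> state_tree n ` U" using U(2) by simp
      show "inj_on parcs (state_tree n ` U)"
      proof (rule inj_onI)
        fix t u assume "t \<in> state_tree n ` U" "u \<in> state_tree n ` U" and eq: "parcs t = parcs u"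
        then have "pverts t = pverts u" by (auto simp: state_tree_def)
        with eq show "t = u" by (cases t; cases u) simp
      qed
      show "finite (parcs t)" if "t \<in> state_tree n ` U" for t
        using that by (auto simp: state_tree_def ring_arcs_def)
    qed
    finally show ?thesis .
  qed
  have Q_minor: "det_on ({1..n} - {i}) (ring_lap n ?p ?m) = det_on ({1..n} - {i}) (\<lambda>k l. - Q k l)" for i
    by (rule det_on_cong) (auto simp: Q_def ring_lap_eq_rates[OF n3])
  have one: "1 \<in> {1..n}" using n3 by simp
  have root: "root_weight n ?p ?m 1 \<noteq> 0"
  proof -
    have "root_weight n ?p ?m 1 = (\<Sum>s\<in>Pair 1 ` {0..<n}. state_weight n ?p ?m s)"
      by (simp add: root_weight_def[OF n3] sum.reindex inj_on_def)
    moreover have "Pair 1 ` {0..<n} \<subseteq> ?S" "(1, 0) \<in> Pair 1 ` {0..<n}"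
      using n3 by (auto simp: tree_states_def)
    ultimately show ?thesis using nonzero[of "Pair 1 ` {0..<n}" "(1, 0)"] by (simp del: One_nat_def)
  qed
  have state: "(1, 0) \<in> ?S" using n3 by (simp add: tree_states_def)
  then have total: "(\<Sum>s\<in>?S. state_weight n ?p ?m s) \<noteq> 0" by (rule nonzero[OF subset_refl])
  have minor: "det_on (?S - {s}) (state_lap n ?p ?m) = state_weight n ?p ?m s * ?\<Psi>"
    if "s \<in> ?S" for s
    using det_state_lap_minor[OF n3 that one root total] by (simp only: Q_minor)
  have main: "det_on (T - {t}) (\<lambda>s u. - R s u) = weight t * ?\<Psi>" if t: "t \<in> T" for t
  proof -
    obtain s where s: "s \<in> ?S" "t = state_tree n s" using t T_image by auto
    have "bij_betw (state_tree n) (?S - {s}) (T - {t})"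
      using bij_betw_state_tree[OF n3] s t by (intro bij_betw_DiffI) (auto simp: T_def)
    then have "det_on (T - {t}) (\<lambda>s u. - R s u)
        = det_on (?S - {s}) (\<lambda>s u. - R (state_tree n s) (state_tree n u))"
      using finite_tree_states[OF n3] by (intro det_on_reindex) simp_all
    also have "\<dots> = det_on (?S - {s}) (state_lap n ?p ?m)"
      unfolding R_def by (rule det_on_cong[OF refl]) (simp only: Diff_iff lifted_matrix_state_tree[OF n3])
    finally show ?thesis using minor[OF s(1)] weight_state[OF s(1)] by (simp only: s(2))
  qed
  moreover have "\<Psi> = ?\<Psi>" if "\<forall>t\<in>T. det_on (T - {t}) (\<lambda>s u. - R s u) = weight t * \<Psi>" for \<Psi>
  proof -
    have t: "state_tree n (1, 0) \<in> T" using state T_image by blast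
    have "weight (state_tree n (1, 0)) * \<Psi> = weight (state_tree n (1, 0)) * ?\<Psi>"
      using bspec[OF that t] main[OF t] by (rule trans[OF sym])
    moreover have "weight (state_tree n (1, 0)) \<noteq> 0"
      using nonzero[of "{(1, 0)}" "(1, 0)"] state by (simp add: weight_state)
    ultimately show ?thesis by simp
  qed
  ultimately show ?thesis by blast
qed

end
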